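(* Let $s\ge1$, $F\in\mathbb{R}^{p\times n}$, $L\in\mathbb{R}^{n\times m}$ be arbitrary. Define block lower-triangular Toeplitz matrices (with $(i,j)$ block depending on $i-j$, $i,j=1,\dots,s+n$): $V_{s+n}$ with blocks $FA_F^{i-j-1}B$ ($i>j$), $I_p$ ($i=j$), $0$ ($i<j$); $\bar R_{s+n}$ with blocks $FA_F^{i-j-1}L$ ($i>j$), $0$ ($i\le j$); $R_{s+n}$ with blocks $CA^{i-j-1}L$ ($i>j$), $I_m$ ($i=j$), $0$ ($i<j$). Let $$\Psi_{s,0}=\begin{bmatrix}0_{sp\times np} & I_{sp} & 0_{sp\times nm} & 0_{sp\times sm}\\ \mathcal{O}_s\tilde{\mathcal{C}}_n & \mathcal{T}_{s,s}(G) & 0_{sm\times nm} & I_{sm}\end{bmatrix},\quad \bar\Psi_{s,0}=\begin{bmatrix}0_{sp\times np} & I_{sp} & 0_{sp\times sm}\\ \mathcal{O}_s\tilde{\mathcal{C}}_n & \mathcal{T}_{s,s}(G) & I_{sm}\end{bmatrix}.$$ Then: (i) $\Psi_s:=\begin{bmatrix}M_s(F) & \hat Y_s(F,L)\\ N_s(F) & \hat X_s(F,L)\end{bmatrix}=\Psi_{s,0}\begin{bmatrix}V_{s+n} & \bar R_{s+n}\\ 0 & R_{s+n}\end{bmatrix}$; (ii) for every solution $(u,y,r,\hat x)$ of the kernel-based model with gain $L$ on an interval containing $[k-n+1,k+s]$, there exists $v\in\mathbb{R}^{(s+n)p}$ such that $$\begin{bmatrix}u_s(k)\\ y_s(k)\end{bmatrix}=\Psi_s\begin{bmatrix}v\\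 r_{s+n}(k-n)\end{bmatrix}=\Psi_{s,0}\begin{bmatrix}\bar v\\ \bar r\end{bmatrix}=\bar\Psi_{s,0}\begin{bmatrix}\bar v\\ \bar r_s(k)\end{bmatrix},$$ where $\bar v=V_{s+n}v+\bar R_{s+n}r_{s+n}(k-n)$, $\bar r=R_{s+n}r_{s+n}(k-n)\in\mathbb{R}^{(s+n)m}$, and $\bar r_s(k)\in\mathbb{R}^{sm}$ denotes the last $sm$ entries of $\bar r$; (iii) $\operatorname{rank}\Psi_s=\operatorname{rank}\Psi_{s,0}=\operatorname{rank}\bar\Psi_{s,0}=s(p+m)$.
   Context: Consider the discrete-time LTI system $x(k+1)=Ax(k)+Bu(k)$, $y(k)=Cx(k)+Du(k)$ with $u\in\mathbb{R}^p$, $x\in\mathbb{R}^n$, $y\in\mathbb{R}^m$, $n\ge 1$, and $(A,B,C,D)$ a minimal (controllable and observable) realization. For a sequence $\phi$ and integers $k$, $s\ge1$, $\phi_s(k)=[\phi(k+1)^T,\dots,\phi(k+s)^T]^T$. For $F\in\mathbb{R}^{p\times n}$, $A_F=A+BF$, $C_F=C+DF$. $\mathcal{O}_s=[C^T,(CA)^T,\dots,(CA^{s-1})^T]^T$; $\tilde{\mathcal{C}}_n=[A^{n-1}B,\ \dots,\ AB,\ B]$; $\mathcal{T}_{s,s}(G)\in\mathbb{R}^{sm\times sp}$ is block lower-triangular Toeplitz with $(i,j)$ block $CA^{i-j-1}B$ ($i>j$), $D$ ($i=j$), $0$ ($i<j$). Kernel-based model with observer gain $L\in\mathbb{R}^{n\times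 m}$: sequences $u,y,r\ (\in\mathbb{R}^m),\hat x$ with $\hat x(k+1)=A\hat x(k)+Bu(k)+Lr(k)$, $y(k)=C\hat x(k)+Du(k)+r(k)$. Finite-sample image representation: $M_s(F)\in\mathbb{R}^{sp\times(s+n)p}$, $N_s(F)\in\mathbb{R}^{sm\times(s+n)p}$ with $(l,j)$ blocks ($l=1,\dots,s$; $j=1,\dots,s+n$) $M_{n+l-j}$, $N_{n+l-j}$, where $M_k=FA_F^{k-1}B$ ($k\ge1$), $M_0=I_p$, $M_k=0$ ($k<0$), $N_k=C_FA_F^{k-1}B$ ($k\ge1$), $N_0=D$, $N_k=0$ ($k<0$). For gains $F,L$: $\hat Y_s(F,L)\in\mathbb{R}^{sp\times(s+n)m}$, $\hat X_s(F,L)\in\mathbb{R}^{sm\times(s+n)m}$ with $(l,j)$ blocks $\hat Y_{n+l-j}$, $\hat X_{n+l-j}$, where $\hat Y_k=FA_F^{k-1}L$ ($k\ge1$), $\hat Y_k=0$ ($k\le0$), $\hat X_k=C_FA_F^{k-1}L$ ($k\ge1$), $\hat X_0=I_m$, $\hat X_k=0$ ($k<0$). *)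

theory Defs
  imports "Jordan_Normal_Form.DL_Rank"
begin

definition blockmat :: "nat \<Rightarrow> nat \<Rightarrow> nat \<Rightarrow> nat \<Rightarrow> (nat \<Rightarrow> nat \<Rightarrow> real mat) \<Rightarrow> real mat" where
  "blockmat rb cb nr nc f =
     mat (nr * rb) (nc * cb) (\<lambda>(a, b). f (a div rb) (b div cb) $$ (a mod rb, b mod cb))"

definition hcat :: "real mat \<Rightarrow> real mat \<Rightarrow> real mat" where
  "hcat X Y = mat (dim_row X) (dim_col X + dim_col Y)
     (\<lambda>(i, j). if j < dim_col X then X $$ (i, j) else Y $$ (i, j - dim_col X))"

definition vcat :: "real mat \<Rightarrow> real mat \<Rightarrow> real mat" where
  "vcat X Y = mat (dim_row X + dim_row Y) (dim_col X)
     (\<lambda>(i, j). if i < dim_row X then X $$ (i, j) else Y $$ (i - dim_row X, j))"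

definition stackv :: "nat \<Rightarrow> nat \<Rightarrow> (nat \<Rightarrow> real vec) \<Rightarrow> real vec" where
  "stackv d N f = vec (N * d) (\<lambda>i. f (i div d) $ (i mod d))"

definition seg :: "nat \<Rightarrow> nat \<Rightarrow> (int \<Rightarrow> real vec) \<Rightarrow> int \<Rightarrow> real vec" where
  "seg d s phi k = stackv d s (\<lambda>l. phi (k + 1 + int l))"

definition mrank :: "real mat \<Rightarrow> nat" where
  "mrank X = vec_space.rank (dim_row X) X"

definition AF :: "real mat \<Rightarrow> real mat \<Rightarrow> real mat \<Rightarrow> real mat" where
  "AF A B F = A + B * F"

definition CF :: "real mat \<Rightarrow> real mat \<Rightarrow> real mat \<Rightarrow> real mat" where
  "CF C D F = C + D * F"

definition obsv :: "nat \<Rightarrow> nat \<Rightarrow> real mat \<Rightarrow> real mat \<Rightarrow> nat \<Rightarrow> real mat" where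
  "obsv n m A C s = blockmat m n s 1 (\<lambda>i j. C * A ^\<^sub>m i)"

definition ctrb_rev :: "nat \<Rightarrow> nat \<Rightarrow> real mat \<Rightarrow> real mat \<Rightarrow> real mat" where
  "ctrb_rev n p A B = blockmat n p 1 n (\<lambda>i j. A ^\<^sub>m (n - 1 - j) * B)"

definition ctrb :: "nat \<Rightarrow> nat \<Rightarrow> real mat \<Rightarrow> real mat \<Rightarrow> real mat" where
  "ctrb n p A B = blockmat n p 1 n (\<lambda>i j. A ^\<^sub>m j * B)"

definition toepT :: "nat \<Rightarrow> nat \<Rightarrow> real mat \<Rightarrow> real mat \<Rightarrow> real mat \<Rightarrow> real mat \<Rightarrow> nat \<Rightarrow> real mat" where
  "toepT m p A B C D s = blockmat m p s s
     (\<lambda>i j. if i > j then C * A ^\<^sub>m (i - j - 1) * B else if i = j then D else 0\<^sub>m m p)"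

definition Mpar :: "nat \<Rightarrow> real mat \<Rightarrow> real mat \<Rightarrow> real mat \<Rightarrow> int \<Rightarrow> real mat" where
  "Mpar p A B F k = (if k \<ge> 1 then F * AF A B F ^\<^sub>m nat (k - 1) * B
                     else if k = 0 then 1\<^sub>m p else 0\<^sub>m p p)"

definition Npar :: "nat \<Rightarrow> nat \<Rightarrow> real mat \<Rightarrow> real mat \<Rightarrow> real mat \<Rightarrow> real mat \<Rightarrow> real mat \<Rightarrow> int \<Rightarrow> real mat" where
  "Npar m p A B C D F k = (if k \<ge> 1 then CF C D F * AF A B F ^\<^sub>m nat (k - 1) * B
                     else if k = 0 then D else 0\<^sub>m m p)"

definition Yhpar :: "nat \<Rightarrow> nat \<Rightarrow> real mat \<Rightarrow> real mat \<Rightarrow> real mat \<Rightarrow> real mat \<Rightarrow> int \<Rightarrow> real mat" where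
  "Yhpar m p A B F L k = (if k \<ge> 1 then F * AF A B F ^\<^sub>m nat (k - 1) * L else 0\<^sub>m p m)"

definition Xhpar :: "nat \<Rightarrow> real mat \<Rightarrow> real mat \<Rightarrow> real mat \<Rightarrow> real mat \<Rightarrow> real mat \<Rightarrow> real mat \<Rightarrow> int \<Rightarrow> real mat" where
  "Xhpar m A B C D F L k = (if k \<ge> 1 then CF C D F * AF A B F ^\<^sub>m nat (k - 1) * L
                     else if k = 0 then 1\<^sub>m m else 0\<^sub>m m m)"

text \<open>Finite-sample image representation; the (l,j) block (1-based) has lag n+l-j,
  which in 0-based block indices l', j' is n+l'-j'.\<close>
definition Ms :: "nat \<Rightarrow> nat \<Rightarrow> real mat \<Rightarrow> real mat \<Rightarrow> real mat \<Rightarrow> nat \<Rightarrow> real mat" where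
  "Ms n p A B F s = blockmat p p s (s + n) (\<lambda>l j. Mpar p A B F (int n + int l - int j))"

definition Ns :: "nat \<Rightarrow> nat \<Rightarrow> nat \<Rightarrow> real mat \<Rightarrow> real mat \<Rightarrow> real mat \<Rightarrow> real mat \<Rightarrow> real mat \<Rightarrow> nat \<Rightarrow> real mat" where
  "Ns n m p A B C D F s = blockmat m p s (s + n) (\<lambda>l j. Npar m p A B C D F (int n + int l - int j))"

definition Yhs :: "nat \<Rightarrow> nat \<Rightarrow> nat \<Rightarrow> real mat \<Rightarrow> real mat \<Rightarrow> real mat \<Rightarrow> real mat \<Rightarrow> nat \<Rightarrow> real mat" where
  "Yhs n m p A B F L s = blockmat p m s (s + n) (\<lambda>l j. Yhpar m p A B F L (int n + int l - int j))"

definition Xhs :: "nat \<Rightarrow> nat \<Rightarrow> real mat \<Rightarrow> real mat \<Rightarrow> real mat \<Rightarrow> real mat \<Rightarrow> real mat \<Rightarrow> real mat \<Rightarrow> nat \<Rightarrow> real mat" where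
  "Xhs n m A B C D F L s = blockmat m m s (s + n) (\<lambda>l j. Xhpar m A B C D F L (int n + int l - int j))"

definition Vmat :: "nat \<Rightarrow> real mat \<Rightarrow> real mat \<Rightarrow> real mat \<Rightarrow> nat \<Rightarrow> real mat" where
  "Vmat p A B F N = blockmat p p N N
     (\<lambda>i j. if i > j then F * AF A B F ^\<^sub>m (i - j - 1) * B else if i = j then 1\<^sub>m p else 0\<^sub>m p p)"

definition Rbarmat :: "nat \<Rightarrow> nat \<Rightarrow> real mat \<Rightarrow> real mat \<Rightarrow> real mat \<Rightarrow> real mat \<Rightarrow> nat \<Rightarrow> real mat" where
  "Rbarmat m p A B F L N = blockmat p m N N
     (\<lambda>i j. if i > j then F * AF A B F ^\<^sub>m (i - j - 1) * L else 0\<^sub>m p m)"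

definition Rmat :: "nat \<Rightarrow> real mat \<Rightarrow> real mat \<Rightarrow> real mat \<Rightarrow> nat \<Rightarrow> real mat" where
  "Rmat m A C L N = blockmat m m N N
     (\<lambda>i j. if i > j then C * A ^\<^sub>m (i - j - 1) * L else if i = j then 1\<^sub>m m else 0\<^sub>m m m)"

definition Psi_s :: "nat \<Rightarrow> nat \<Rightarrow> nat \<Rightarrow> real mat \<Rightarrow> real mat \<Rightarrow> real mat \<Rightarrow> real mat \<Rightarrow> real mat \<Rightarrow> real mat \<Rightarrow> nat \<Rightarrow> real mat" where
  "Psi_s n m p A B C D F L s =
     vcat (hcat (Ms n p A B F s) (Yhs n m p A B F L s))
          (hcat (Ns n m p A B C D F s) (Xhs n m A B C D F L s))"

definition Psi_s0 :: "nat \<Rightarrow> nat \<Rightarrow> nat \<Rightarrow> real mat \<Rightarrow> real mat \<Rightarrow> real mat \<Rightarrow> real mat \<Rightarrow> nat \<Rightarrow> real mat" where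
  "Psi_s0 n m p A B C D s =
     vcat (hcat (hcat (hcat (0\<^sub>m (s * p) (n * p)) (1\<^sub>m (s * p))) (0\<^sub>m (s * p) (n * m))) (0\<^sub>m (s * p) (s * m)))
          (hcat (hcat (hcat (obsv n m A C s * ctrb_rev n p A B) (toepT m p A B C D s)) (0\<^sub>m (s * m) (n * m))) (1\<^sub>m (s * m)))"

definition Psibar_s0 :: "nat \<Rightarrow> nat \<Rightarrow> nat \<Rightarrow> real mat \<Rightarrow> real mat \<Rightarrow> real mat \<Rightarrow> real mat \<Rightarrow> nat \<Rightarrow> real mat" where
  "Psibar_s0 n m p A B C D s =
     vcat (hcat (hcat (0\<^sub>m (s * p) (n * p)) (1\<^sub>m (s * p))) (0\<^sub>m (s * p) (s * m)))
          (hcat (hcat (obsv n m A C s * ctrb_rev n p A B) (toepT m p A B C D s)) (1\<^sub>m (s * m)))"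

definition Theta :: "nat \<Rightarrow> nat \<Rightarrow> nat \<Rightarrow> real mat \<Rightarrow> real mat \<Rightarrow> real mat \<Rightarrow> real mat \<Rightarrow> real mat \<Rightarrow> nat \<Rightarrow> real mat" where
  "Theta n m p A B C F L s =
     vcat (hcat (Vmat p A B F (s + n)) (Rbarmat m p A B F L (s + n)))
          (hcat (0\<^sub>m ((s + n) * m) ((s + n) * p)) (Rmat m A C L (s + n)))"

definition minimal_real :: "nat \<Rightarrow> nat \<Rightarrow> nat \<Rightarrow> real mat \<Rightarrow> real mat \<Rightarrow> real mat \<Rightarrow> bool" where
  "minimal_real n m p A B C \<longleftrightarrow> mrank (ctrb n p A B) = n \<and> mrank (obsv n m A C n) = n"

end

theory Submission
  imports Defs
begin

text \<open>
  Let \<open>E = [0 I]\<close> select the last \<open>s\<close> blocks and let \<open>H\<close> be the last \<open>s\<close> block rows of the full Toeplitz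
  matrix of Markov parameters; then \<open>H\<close> is the row \<open>[O C~, T]\<close>, and \<open>\<Psi>\<close> with index \<open>(s, 0)\<close> is the
  \<open>2\<times>2\<close> block matrix with rows \<open>[E, 0]\<close> and \<open>[H, E]\<close>. Part (i) is then the variation-of-constants formula
  for \<open>x(k+1) = A x(k) + B (F x(k))\<close>. For (ii), controllability gives \<open>n\<close> virtual inputs steering
  the zero state at time \<open>k - n + 1\<close>, in the presence of the residuals, to the actual state at time
  \<open>k + 1\<close>; since \<open>V\<close> is unit lower triangular, every \<open>v\<close>-bar is attained by some \<open>v\<close>.
  For (iii), the identity blocks make the block rows surjective, and so is the unit block triangular
  right factor; full row rank is surjectivity.
\<close>

section \<open>Rank and block matrices\<close>

text \<open>The columns live in a space of dimension \<open>nr\<close>, so rank \<open>nr\<close>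
  forces their span to be everything, and this span is exactly the set of products
  \<open>X *\<^sub>v x\<close>. All rank claims, and the controllability hypothesis, are handled as
  solvability of linear equations through this equivalence.\<close>

lemma mrank_eq_dim_row_iff:
  assumes X: "X \<in> carrier_mat nr nc"
  shows "mrank X = nr \<longleftrightarrow> (\<forall>y\<in>carrier_vec nr. \<exists>x\<in>carrier_vec nc. X *\<^sub>v x = y)"
proof -
  interpret vec_space "TYPE(real)" nr .
  have cols: "set (cols X) \<subseteq> carrier_vec nr" using cols_dim[of X] X by auto
  have "mrank X = nr \<longleftrightarrow> span (set (cols X)) = carrier_vec nr"
  proof
    assume r: "mrank X = nr"
    \<comment> \<open>The rank is the size of a maximal independent set of columns. With
      \<open>nr\<close> elements such a set is already a basis.\<close>
    obtain S where S: "maximal S (\<lambda>T. T \<subseteq> set (cols X) \<and> lin_indpt T)"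
      using maximal_exists[of "(\<lambda>T. T \<subseteq> set (cols X) \<and> lin_indpt T)" "card (set (cols X))" "{}"]
      by (meson List.finite_set card_mono empty_iff empty_subsetI finite_lin_indpt2 rev_finite_subset)
    have "card S = dim"
      using r rank_card_indpt[OF X S] X by (simp add: mrank_def dim_is_n)
    moreover have Sub: "S \<subseteq> set (cols X)" and li: "lin_indpt S" using S by (auto simp: maximal_def)
    moreover have "finite S" using Sub finite_subset by blast
    ultimately have "basis S" using dim_li_is_basis[of S] cols fin_dim by auto
    then have "span S = carrier_vec nr" by (simp add: basis_def)
    then show "span (set (cols X)) = carrier_vec nr"
      using span_is_monotone[OF Sub] span_is_subset2[of "set (cols X)"] cols by auto
  next
    assume "span (set (cols X)) = carrier_vec nr"
    then have "mrank X = vectorspace.dim class_ring (vs (carrier_vec nr))"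
      using X by (simp add: mrank_def rank_def)
    also have "vs (carrier_vec nr) = V" by (simp add: module_vec_def)
    finally show "mrank X = nr" by (simp add: dim_is_n)
  qed
  also have "\<dots> \<longleftrightarrow> (\<forall>y\<in>carrier_vec nr. \<exists>x\<in>carrier_vec nc. X *\<^sub>v x = y)"
    using col_space_eq[OF X] X unfolding col_space_def by auto
  finally show ?thesis .
qed

text \<open>The determinant is the product of the diagonal entries, here 1, so the matrix has an
  inverse that yields the preimage.\<close>

lemma unit_lower_triangular_mult_surj:
  fixes X :: "real mat"
  assumes X: "X \<in> carrier_mat N N"
    and tri: "\<And>i j. i < j \<Longrightarrow> j < N \<Longrightarrow> X $$ (i, j) = 0"
    and unit: "\<And>i. i < N \<Longrightarrow> X $$ (i, i) = 1"
    and y: "y \<in> carrier_vec N"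
  obtains x where "x \<in> carrier_vec N" "X *\<^sub>v x = y"
proof -
  have "prod_list (diag_mat X) = 1"
    using X unit by (simp add: prod_list_diag_prod)
  then have "det X \<noteq> 0" using det_lower_triangular[OF tri X] by simp
  then have "X \<in> Units (ring_mat TYPE(real) N ())" by (rule det_non_zero_imp_unit[OF X])
  then obtain Y where Y: "Y \<in> carrier_mat N N" "X * Y = 1\<^sub>m N"
    unfolding Units_def ring_mat_def by auto
  have "X *\<^sub>v (Y *\<^sub>v y) = y"
    using X Y y by (metis assoc_mult_mat_vec one_mult_mat_vec)
  then show ?thesis using that Y y by (metis mult_mat_vec_carrier)
qed

section \<open>Block index arithmetic and products of block matrices\<close>

lemma block_index_split:
  fixes i d N :: nat
  assumes "i < N * d"
  shows "i div d < N" "i mod d < d"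
  using assms by (auto simp: less_mult_imp_div_less) (metis mod_less_divisor mult_is_0 neq0_conv not_less_zero)

text \<open>The flat range is cut into \<open>N\<close> consecutive runs of length \<open>d\<close>.
  This turns a scalar product over flat indices into a sum over blocks of scalar products within a
  block.\<close>

lemma sum_blocks:
  fixes h :: "nat \<Rightarrow> nat \<Rightarrow> real"
  shows "(\<Sum>b<N * d. h (b div d) (b mod d)) = (\<Sum>j<N. \<Sum>c<d. h j c)"
proof -
  have "(\<Sum>b<N * d. h (b div d) (b mod d))
      = (\<Sum>j<N. \<Sum>b\<in>{j * d..<j * d + d}. h (b div d) (b mod d))"
    by (simp add: sum.nat_group)
  also have "\<dots> = (\<Sum>j<N. \<Sum>c<d. h j c)"
  proof (rule sum.cong[OF refl])
    fix j
    have "(\<Sum>b\<in>{j * d..<j * d + d}. h (b div d) (b mod d))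
        = (\<Sum>c\<in>{0..<d}. h ((c + j * d) div d) ((c + j * d) mod d))"
      using sum.shift_bounds_nat_ivl[of "\<lambda>b. h (b div d) (b mod d)" 0 "j * d" d]
      by (simp add: add.commute)
    also have "\<dots> = (\<Sum>c<d. h j c)"
      by (rule sum.cong) auto
    finally show "(\<Sum>b\<in>{j * d..<j * d + d}. h (b div d) (b mod d)) = (\<Sum>c<d. h j c)" .
  qed
  finally show ?thesis .
qed

lemma blockmat_carrier [simp]: "blockmat rb cb nr nc f \<in> carrier_mat (nr * rb) (nc * cb)"
  and dim_row_blockmat [simp]: "dim_row (blockmat rb cb nr nc f) = nr * rb"
  and dim_col_blockmat [simp]: "dim_col (blockmat rb cb nr nc f) = nc * cb"
  by (auto simp: blockmat_def)

lemma index_blockmat: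
  "i < nr * rb \<Longrightarrow> j < nc * cb \<Longrightarrow>
   blockmat rb cb nr nc f $$ (i, j) = f (i div rb) (j div cb) $$ (i mod rb, j mod cb)"
  by (simp add: blockmat_def)

text \<open>Agreement is required only at entries inside the blocks, because \<open>blockmat\<close>
  reads nothing else; the dimensions of the blocks themselves need not be compared.\<close>

lemma blockmat_cong:
  assumes "\<And>i j a b. i < nr \<Longrightarrow> j < nc \<Longrightarrow> a < rb \<Longrightarrow> b < cb \<Longrightarrow> f i j $$ (a, b) = g i j $$ (a, b)"
  shows "blockmat rb cb nr nc f = blockmat rb cb nr nc g"
  using assms by (intro eq_matI) (auto simp: index_blockmat block_index_split)

lemma stackv_carrier [simp]: "stackv d N f \<in> carrier_vec (N * d)"
  and dim_stackv [simp]: "dim_vec (stackv d N f) = N * d"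
  by (auto simp: stackv_def)

lemma stackv_cong:
  assumes "\<And>i a. i < N \<Longrightarrow> a < d \<Longrightarrow> f i $ a = g i $ a"
  shows "stackv d N f = stackv d N g"
  using assms by (intro eq_vecI) (auto simp: stackv_def block_index_split)

lemma stackv_of_vec:
  assumes "v \<in> carrier_vec (N * d)"
  shows "v = stackv d N (\<lambda>j. vec d (\<lambda>a. v $ (j * d + a)))"
  using assms by (intro eq_vecI) (auto simp: stackv_def block_index_split)

text \<open>The blocks of the product are given by real sums of entries, so that no sum of matrices
  has to be formed.\<close>

lemma blockmat_mult_blockmat:
  assumes f: "\<And>i j. i < nr \<Longrightarrow> j < nc \<Longrightarrow> f i j \<in> carrier_mat rb cb"
    and g: "\<And>j k. j < nc \<Longrightarrow> k < nk \<Longrightarrow> g j k \<in> carrier_mat cb kb"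
  shows "blockmat rb cb nr nc f * blockmat cb kb nc nk g
    = blockmat rb kb nr nk (\<lambda>i k. mat rb kb (\<lambda>(a, b). \<Sum>j<nc. (f i j * g j k) $$ (a, b)))"
proof (rule eq_matI, goal_cases)
  case (1 x y)
  then have x: "x < nr * rb" and y: "y < nk * kb" by auto
  define i k a b where "i = x div rb" and "k = y div kb" and "a = x mod rb" and "b = y mod kb"
  have ik: "i < nr" "a < rb" "k < nk" "b < kb"
    using block_index_split[OF x] block_index_split[OF y] by (auto simp: i_def k_def a_def b_def)
  have "(blockmat rb cb nr nc f * blockmat cb kb nc nk g) $$ (x, y)
      = (\<Sum>c<nc * cb. f i (c div cb) $$ (a, c mod cb) * g (c div cb) k $$ (c mod cb, b))"
    using x y by (simp add: scalar_prod_def index_blockmat i_def k_def a_def b_def atLeast0LessThan)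
  also have "\<dots> = (\<Sum>j<nc. \<Sum>c<cb. f i j $$ (a, c) * g j k $$ (c, b))"
    by (rule sum_blocks)
  also have "\<dots> = (\<Sum>j<nc. (f i j * g j k) $$ (a, b))"
  proof (rule sum.cong[OF refl])
    fix j assume "j \<in> {..<nc}"
    then have "f i j \<in> carrier_mat rb cb" "g j k \<in> carrier_mat cb kb" using f g ik by auto
    then show "(\<Sum>c<cb. f i j $$ (a, c) * g j k $$ (c, b)) = (f i j * g j k) $$ (a, b)"
      using ik by (simp add: scalar_prod_def atLeast0LessThan)
  qed
  finally show ?case using x y ik
    by (simp add: index_blockmat i_def k_def a_def b_def)
qed auto

lemma blockmat_mult_stackv:
  assumes f: "\<And>i j. i < nr \<Longrightarrow> j < nc \<Longrightarrow> f i j \<in> carrier_mat rb cb"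
    and g: "\<And>j. j < nc \<Longrightarrow> g j \<in> carrier_vec cb"
  shows "blockmat rb cb nr nc f *\<^sub>v stackv cb nc g
    = stackv rb nr (\<lambda>i. vec rb (\<lambda>a. \<Sum>j<nc. (f i j *\<^sub>v g j) $ a))"
proof (rule eq_vecI, goal_cases)
  case (1 x)
  then have x: "x < nr * rb" by auto
  define i a where "i = x div rb" and "a = x mod rb"
  have ik: "i < nr" "a < rb" using block_index_split[OF x] by (auto simp: i_def a_def)
  have "(blockmat rb cb nr nc f *\<^sub>v stackv cb nc g) $ x
      = (\<Sum>c<nc * cb. f i (c div cb) $$ (a, c mod cb) * g (c div cb) $ (c mod cb))"
    using x by (simp add: scalar_prod_def index_blockmat stackv_def i_def a_def atLeast0LessThan)
  also have "\<dots> = (\<Sum>j<nc. \<Sum>c<cb. f i j $$ (a, c) * g j $ c)"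
    by (rule sum_blocks)
  also have "\<dots> = (\<Sum>j<nc. (f i j *\<^sub>v g j) $ a)"
  proof (rule sum.cong[OF refl])
    fix j assume "j \<in> {..<nc}"
    then have "f i j \<in> carrier_mat rb cb" "g j \<in> carrier_vec cb" using f g ik by auto
    then show "(\<Sum>c<cb. f i j $$ (a, c) * g j $ c) = (f i j *\<^sub>v g j) $ a"
      using ik by (simp add: scalar_prod_def atLeast0LessThan)
  qed
  finally show ?case using x ik by (simp add: stackv_def i_def a_def)
qed auto

lemma zero_mat_blockmat: "0\<^sub>m (nr * rb) (nc * cb) = blockmat rb cb nr nc (\<lambda>i j. 0\<^sub>m rb cb)"
  by (intro eq_matI) (auto simp: index_blockmat block_index_split)

lemma one_mat_blockmat:
  "1\<^sub>m (N * d) = blockmat d d N N (\<lambda>i j. if i = j then 1\<^sub>m d else 0\<^sub>m d d)"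
proof (rule eq_matI, goal_cases)
  case (1 x y)
  have "x = y \<longleftrightarrow> x div d = y div d \<and> x mod d = y mod d"
    by (metis div_mult_mod_eq)
  then show ?case using 1 by (auto simp: index_blockmat block_index_split)
qed auto

lemma hcat_blockmat:
  "hcat (blockmat rb cb nr n1 f) (blockmat rb cb nr n2 g)
    = blockmat rb cb nr (n1 + n2) (\<lambda>i j. if j < n1 then f i j else g i (j - n1))"
proof (rule eq_matI, goal_cases)
  case (1 x y)
  then have x: "x < nr * rb" and y: "y < (n1 + n2) * cb" by auto
  then have cb: "cb > 0" by (cases cb) auto
  show ?case
  proof (cases "y < n1 * cb")
    case True
    then show ?thesis using x y block_index_split[OF True] by (simp add: hcat_def index_blockmat algebra_simps)
  next
    case False
    then obtain z where z: "y = n1 * cb + z" by (metis le_Suc_ex not_less)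
    then have "y div cb = n1 + z div cb" "y mod cb = z mod cb" using cb by auto
    moreover have "z < n2 * cb" using z y by (simp add: algebra_simps)
    ultimately show ?thesis using x y z by (simp add: hcat_def index_blockmat algebra_simps)
  qed
qed (auto simp: hcat_def algebra_simps)

text \<open>\<open>hcat\<close> takes its row count from its left argument, so
  \<open>hcat Y Z\<close> fits beside \<open>X\<close> only if \<open>Y\<close> has as many rows as
  \<open>X\<close>.\<close>

lemma hcat_assoc:
  assumes "dim_row Y = dim_row X"
  shows "hcat (hcat X Y) Z = hcat X (hcat Y Z)"
  using assms by (intro eq_matI) (auto simp: hcat_def)

lemma hcat_zero: "hcat (0\<^sub>m nr n1) (0\<^sub>m nr n2) = 0\<^sub>m nr (n1 + n2)"
  by (intro eq_matI) (auto simp: hcat_def)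

lemma vcat_hcat_four_block:
  assumes "X \<in> carrier_mat nr1 nc1" "Y \<in> carrier_mat nr1 nc2"
    "Z \<in> carrier_mat nr2 nc1" "W \<in> carrier_mat nr2 nc2"
  shows "vcat (hcat X Y) (hcat Z W) = four_block_mat X Y Z W"
  using assms by (intro eq_matI) (auto simp: hcat_def vcat_def)

section \<open>Matrix powers and the variation-of-constants formula\<close>

lemma pow_mat_Suc_left:
  fixes A :: "real mat"
  assumes A: "A \<in> carrier_mat n n"
  shows "A * A ^\<^sub>m k = A ^\<^sub>m Suc k"
proof (induction k)
  case (Suc k)
  have "A * A ^\<^sub>m Suc k = (A * A ^\<^sub>m k) * A"
    using A by (simp add: assoc_mult_mat[of _ n n _ n _ n])
  then show ?case using Suc by simp
qed (use A in auto)

lemma pow_mat_add: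
  fixes A :: "real mat"
  assumes A: "A \<in> carrier_mat n n"
  shows "A ^\<^sub>m (i + j) = A ^\<^sub>m i * A ^\<^sub>m j"
proof (induction j)
  case (Suc j)
  then show ?case using A by (simp add: assoc_mult_mat[of _ n n _ n _ n])
qed (use A in auto)

lemma mult_mat_assoc_dim:
  fixes X Y Z :: "real mat"
  assumes "dim_col X = dim_row Y" "dim_col Y = dim_row Z"
  shows "X * Y * Z = X * (Y * Z)"
  using assms by (intro assoc_mult_mat[of _ "dim_row X" "dim_row Y" _ "dim_row Z" _ "dim_col Z"]) auto

text \<open>Induction on \<open>K\<close> with \<open>M\<close> arbitrary: unfolding the last step
  turns \<open>M\<close> applied to \<open>x (Suc K)\<close> into \<open>M * A\<close> applied to
  \<open>x K\<close> plus a new input term, so the induction hypothesis is needed for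
  \<open>M * A\<close>. The choice \<open>M = C\<close> reads an output, the identity reads the
  state. Carrier and step conditions are confined to the window because the sequences are only
  controlled there.\<close>

lemma variation_of_constants_vec:
  fixes A M :: "real mat" and x w :: "nat \<Rightarrow> real vec"
  assumes A: "A \<in> carrier_mat n n" and M: "M \<in> carrier_mat q n"
    and x: "\<And>j. j \<le> K \<Longrightarrow> x j \<in> carrier_vec n" and w: "\<And>j. j < K \<Longrightarrow> w j \<in> carrier_vec n"
    and step: "\<And>j. j < K \<Longrightarrow> x (Suc j) = A *\<^sub>v x j + w j"
    and a: "a < q"
  shows "(M *\<^sub>v x K) $ a = (M * A ^\<^sub>m K *\<^sub>v x 0) $ a + (\<Sum>j<K. (M * A ^\<^sub>m (K - j - 1) *\<^sub>v w j) $ a)"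
  using M x w step
proof (induction K arbitrary: M)
  case 0
  then show ?case using A by auto
next
  case (Suc K)
  have MA: "M * A \<in> carrier_mat q n" using Suc.prems(1) A by auto
  have pow: "M * A * A ^\<^sub>m i = M * A ^\<^sub>m Suc i" for i
    using pow_mat_Suc_left[OF A, of i] Suc.prems(1) A
    by (simp add: assoc_mult_mat[of _ q n _ n _ n])
  have "M *\<^sub>v x (Suc K) = M * A *\<^sub>v x K + M *\<^sub>v w K"
    using Suc.prems A by (simp add: mult_add_distrib_mat_vec[of _ q n])
  then have "(M *\<^sub>v x (Suc K)) $ a = (M * A *\<^sub>v x K) $ a + (M *\<^sub>v w K) $ a"
    using a MA Suc.prems by simp
  also have "(M * A *\<^sub>v x K) $ a = (M * A * A ^\<^sub>m K *\<^sub>v x 0) $ a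
      + (\<Sum>j<K. (M * A * A ^\<^sub>m (K - j - 1) *\<^sub>v w j) $ a)"
    using Suc.IH[OF MA] Suc.prems by simp
  also have "(\<Sum>j<K. (M * A * A ^\<^sub>m (K - j - 1) *\<^sub>v w j) $ a)
      = (\<Sum>j<K. (M * A ^\<^sub>m (Suc K - j - 1) *\<^sub>v w j) $ a)"
    by (rule sum.cong[OF refl]) (simp only: pow, simp add: Suc_diff_Suc)
  finally show ?case using pow[of K] Suc.prems(1) A by simp
qed

text \<open>Column \<open>b\<close> of a matrix recursion is a vector recursion, to which the
  previous formula applies.\<close>

lemma variation_of_constants_mat:
  fixes A M :: "real mat" and X W :: "nat \<Rightarrow> real mat"
  assumes A: "A \<in> carrier_mat n n" and M: "M \<in> carrier_mat q n"
    and X: "\<And>j. X j \<in> carrier_mat n r" and W: "\<And>j. W j \<in> carrier_mat n r"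
    and step: "\<And>j. X (Suc j) = A * X j + W j"
    and a: "a < q" and b: "b < r"
  shows "(M * X K) $$ (a, b)
    = (M * A ^\<^sub>m K * X 0) $$ (a, b) + (\<Sum>j<K. (M * A ^\<^sub>m (K - j - 1) * W j) $$ (a, b))"
proof -
  have idx: "(P * Q) $$ (a, b) = (P *\<^sub>v col Q b) $ a"
    if "P \<in> carrier_mat q n" "Q \<in> carrier_mat n r" for P Q :: "real mat"
    using that a b by simp
  have pow: "M * A ^\<^sub>m i \<in> carrier_mat q n" for i using M A by auto
  have "col (X (Suc j)) b = A *\<^sub>v col (X j) b + col (W j) b" for j
    unfolding step using A X[of j] W[of j] b by (intro eq_vecI) auto
  then show ?thesis
    unfolding idx[OF M X] idx[OF pow X] idx[OF pow W]
    using X W by (intro variation_of_constants_vec[OF A M _ _ _ a]) (auto simp: carrier_dim_vec)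
qed

text \<open>An entry above the flat diagonal lies either in a zero block above the block diagonal or
  off the diagonal of an identity block, so the matrix is unit lower triangular entrywise.\<close>

lemma unit_block_lower_triangular_mult_surj:
  assumes diag: "\<And>i. i < N \<Longrightarrow> f i i = 1\<^sub>m d"
    and upper: "\<And>i j. i < j \<Longrightarrow> j < N \<Longrightarrow> f i j = 0\<^sub>m d d"
    and y: "y \<in> carrier_vec (N * d)"
  obtains x where "x \<in> carrier_vec (N * d)" "blockmat d d N N f *\<^sub>v x = y"
proof (rule unit_lower_triangular_mult_surj[OF blockmat_carrier _ _ y])
  fix i j assume ij: "i < j" "j < N * d"
  then have i: "i < N * d" by simp
  note idx = block_index_split[OF i] block_index_split[OF ij(2)]
  have "i div d \<le> j div d" using ij by (intro div_le_mono) simp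
  then consider "i div d < j div d" | "i div d = j div d" "i mod d \<noteq> j mod d"
    using ij by (metis div_mult_mod_eq le_neq_implies_less nat_neq_iff)
  then show "blockmat d d N N f $$ (i, j) = 0"
    using i ij idx diag upper by cases (auto simp: index_blockmat)
next
  fix i assume i: "i < N * d"
  then show "blockmat d d N N f $$ (i, i) = 1"
    using block_index_split[OF i] diag by (simp add: index_blockmat)
qed (use that in blast)

lemma vec_diff_add_cancel:
  fixes x y :: "real vec"
  assumes "x \<in> carrier_vec d" "y \<in> carrier_vec d"
  shows "y + (x - y) = x" "x - y + y = x"
  using assms by (auto intro!: eq_vecI)

lemma vec_last_append:
  assumes "w \<in> carrier_vec d"
  shows "vec_last (v @\<^sub>v w) d = w"
  using assms by (intro eq_vecI) (auto simp: vec_last_def)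

lemma sum_lower_triangular:
  fixes h :: "nat \<Rightarrow> real"
  assumes "K < N"
  shows "(\<Sum>j<N. if K > j then h j else if K = j then e else 0) = (\<Sum>j<K. h j) + e"
proof -
  have "(\<Sum>j<N. if K > j then h j else if K = j then e else 0)
      = (\<Sum>j<Suc K. if K > j then h j else if K = j then e else 0)"
    using assms by (intro sum.mono_neutral_right) auto
  then show ?thesis by simp
qed

section \<open>Selection of the last \<open>s\<close> of \<open>s + n\<close> blocks, the matrix
  \<open>E\<close> of the overview\<close>

definition last_blocks :: "nat \<Rightarrow> nat \<Rightarrow> nat \<Rightarrow> real mat" where
  "last_blocks q n s = blockmat q q s (s + n) (\<lambda>l j. if j = n + l then 1\<^sub>m q else 0\<^sub>m q q)"

lemma last_blocks_carrier [simp]: "last_blocks q n s \<in> carrier_mat (s * q) ((s + n) * q)"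
  by (simp add: last_blocks_def)

lemma hcat_zero_one: "hcat (0\<^sub>m (s * q) (n * q)) (1\<^sub>m (s * q)) = last_blocks q n s"
  unfolding zero_mat_blockmat one_mat_blockmat hcat_blockmat last_blocks_def add.commute[of s n]
  by (rule blockmat_cong) auto

text \<open>Each block row of \<open>last_blocks\<close> contains a single identity block, so only
  the summand \<open>j = n + l\<close> survives.\<close>

lemma last_blocks_mult_blockmat:
  assumes g: "\<And>j k. j < s + n \<Longrightarrow> k < nk \<Longrightarrow> g j k \<in> carrier_mat q c"
  shows "last_blocks q n s * blockmat q c (s + n) nk g = blockmat q c s nk (\<lambda>l k. g (n + l) k)"
  unfolding last_blocks_def
proof (subst blockmat_mult_blockmat, goal_cases)
  case 3
  show ?case
  proof (rule blockmat_cong)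
    fix l k a b assume lk: "l < s" "k < nk" "a < q" "b < c"
    have "(\<Sum>j<s + n. ((if j = n + l then 1\<^sub>m q else 0\<^sub>m q q) * g j k) $$ (a, b))
        = (\<Sum>j<s + n. if j = n + l then g (n + l) k $$ (a, b) else 0)"
      using g lk by (intro sum.cong) (auto simp: left_mult_zero_mat[of _ q c] left_mult_one_mat[of _ q c])
    then show "mat q c (\<lambda>(a, b). \<Sum>j<s + n. ((if j = n + l then 1\<^sub>m q else 0\<^sub>m q q) * g j k) $$ (a, b)) $$ (a, b)
        = g (n + l) k $$ (a, b)"
      using lk by simp
  qed
qed (use g in auto)

lemma last_blocks_mult_stackv:
  assumes g: "\<And>j. j < s + n \<Longrightarrow> g j \<in> carrier_vec q"
  shows "last_blocks q n s *\<^sub>v stackv q (s + n) g = stackv q s (\<lambda>l. g (n + l))"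
  unfolding last_blocks_def
proof (subst blockmat_mult_stackv, goal_cases)
  case 3
  show ?case
  proof (rule stackv_cong)
    fix l a assume lk: "l < s" "a < q"
    have "(\<Sum>j<s + n. ((if j = n + l then 1\<^sub>m q else 0\<^sub>m q q) *\<^sub>v g j) $ a)
        = (\<Sum>j<s + n. if j = n + l then g (n + l) $ a else 0)"
      using g lk by (intro sum.cong) auto
    then show "vec q (\<lambda>a. \<Sum>j<s + n. ((if j = n + l then 1\<^sub>m q else 0\<^sub>m q q) *\<^sub>v g j) $ a) $ a
        = g (n + l) $ a"
      using lk by simp
  qed
qed (use g in auto)

text \<open>Cutting \<open>v\<close> into blocks of length \<open>q\<close> reduces this to the
  stacked case: block \<open>n + l\<close> starts at position \<open>(n + l) * q\<close>, hence the
  selected blocks form the tail of \<open>v\<close>.\<close>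

lemma last_blocks_mult_vec:
  assumes v: "v \<in> carrier_vec ((s + n) * q)"
  shows "last_blocks q n s *\<^sub>v v = vec_last v (s * q)"
proof -
  let ?g = "\<lambda>j. vec q (\<lambda>a. v $ (j * q + a))"
  have "last_blocks q n s *\<^sub>v v = last_blocks q n s *\<^sub>v stackv q (s + n) ?g"
    using stackv_of_vec[OF v] by simp
  also have "\<dots> = stackv q s (\<lambda>l. ?g (n + l))"
    by (rule last_blocks_mult_stackv) auto
  also have "\<dots> = vec_last v (s * q)"
  proof (rule eq_vecI, goal_cases)
    case (1 i)
    then have i: "i < s * q" by simp
    have "(n + i div q) * q + i mod q = n * q + i" by (simp add: algebra_simps)
    then show ?case using i v block_index_split[OF i]
      by (simp add: stackv_def vec_last_def algebra_simps)
  qed simp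
  finally show ?thesis .
qed

text \<open>Reconciles the integer lags of \<open>Mpar\<close>, \<open>Npar\<close>,
  \<open>Yhpar\<close> and \<open>Xhpar\<close> with the natural-number lags of the Toeplitz blocks.
  Both \<open>nat\<close> and truncated subtraction send negative values to 0, so no side condition
  arises.\<close>

lemma nat_lag: "nat (int i + int l - int k - 1) = i + l - k - 1"
  by linarith

section \<open>Toeplitz matrices of the system\<close>

text \<open>The block function of \<open>toepT\<close>, named separately because \<open>H\<close>
  evaluates it on the shifted rows \<open>n + l\<close>.\<close>

definition markov_block :: "nat \<Rightarrow> nat \<Rightarrow> real mat \<Rightarrow> real mat \<Rightarrow> real mat \<Rightarrow> real mat \<Rightarrow> nat \<Rightarrow> nat \<Rightarrow> real mat"
  where "markov_block m p A B C D i j =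
    (if i > j then C * A ^\<^sub>m (i - j - 1) * B else if i = j then D else 0\<^sub>m m p)"

locale lti_with_gains =
  fixes n m p :: nat and A B C D F L :: "real mat"
  assumes A [simp]: "A \<in> carrier_mat n n" and B [simp]: "B \<in> carrier_mat n p"
    and C [simp]: "C \<in> carrier_mat m n" and D [simp]: "D \<in> carrier_mat m p"
    and F [simp]: "F \<in> carrier_mat p n" and L [simp]: "L \<in> carrier_mat n m"
begin

abbreviation "G \<equiv> markov_block m p A B C D"
abbreviation "A\<^sub>F \<equiv> AF A B F"
abbreviation "C\<^sub>F \<equiv> CF C D F"

lemma AF_carrier [simp]: "A\<^sub>F \<in> carrier_mat n n"
  and CF_carrier [simp]: "C\<^sub>F \<in> carrier_mat m n"
  unfolding AF_def CF_def carrier_mat_def by (auto simp: carrier_matD[OF B] carrier_matD[OF F] carrier_matD[OF D])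

lemmas dims [simp] = carrier_matD[OF A] carrier_matD[OF B] carrier_matD[OF C] carrier_matD[OF D]
  carrier_matD[OF F] carrier_matD[OF L] carrier_matD[OF AF_carrier] carrier_matD[OF CF_carrier]

lemma pow_dims [simp]:
  "dim_row (A ^\<^sub>m k) = n" "dim_col (A ^\<^sub>m k) = n"
  "dim_row (A\<^sub>F ^\<^sub>m k) = n" "dim_col (A\<^sub>F ^\<^sub>m k) = n"
  by auto

lemma G_carrier [simp]: "G i j \<in> carrier_mat m p"
  unfolding markov_block_def carrier_mat_def by auto

definition H :: "nat \<Rightarrow> real mat" where
  "H s = blockmat m p s (s + n) (\<lambda>l j. G (n + l) j)"

lemma H_carrier [simp]: "H s \<in> carrier_mat (s * m) ((s + n) * p)"
  by (simp add: H_def)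

text \<open>Block \<open>(l, k)\<close> of the observability-controllability product is the Markov
  parameter of lag \<open>n + l - k\<close>. The remaining columns follow by shift invariance, since
  lag \<open>l - j\<close> is the lag of row \<open>n + l\<close> and column
  \<open>n + j\<close>.\<close>

lemma hcat_obsv_ctrb_toepT:
  "hcat (obsv n m A C s * ctrb_rev n p A B) (toepT m p A B C D s) = H s"
proof -
  \<comment> \<open>The inner block index takes the single value 0: one block column meets one block
    row.\<close>
  have "obsv n m A C s * ctrb_rev n p A B
      = blockmat m p s n (\<lambda>i k. mat m p (\<lambda>(a, b). \<Sum>j<(1::nat). (C * A ^\<^sub>m i * (A ^\<^sub>m (n - 1 - k) * B)) $$ (a, b)))"
    unfolding obsv_def ctrb_rev_def
    by (rule blockmat_mult_blockmat[where f = "\<lambda>i j. C * A ^\<^sub>m i" and g = "\<lambda>j k. A ^\<^sub>m (n - 1 - k) * B"])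
      (auto intro: carrier_matI)
  also have "\<dots> = blockmat m p s n (\<lambda>l j. G (n + l) j)"
  proof (rule blockmat_cong)
    fix l k a b assume lk: "l < s" "k < n" "a < m" "b < p"
    have "C * A ^\<^sub>m l * (A ^\<^sub>m (n - 1 - k) * B) = C * (A ^\<^sub>m l * A ^\<^sub>m (n - 1 - k)) * B"
      by (simp add: mult_mat_assoc_dim)
    also have "A ^\<^sub>m l * A ^\<^sub>m (n - 1 - k) = A ^\<^sub>m (n + l - k - 1)"
      using lk by (subst pow_mat_add[OF A, symmetric]) (simp add: algebra_simps)
    finally show "mat m p (\<lambda>(a, b). \<Sum>j<(1::nat). (C * A ^\<^sub>m l * (A ^\<^sub>m (n - 1 - k) * B)) $$ (a, b)) $$ (a, b)
        = G (n + l) k $$ (a, b)"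
      using lk by (simp add: markov_block_def)
  qed
  finally have OC: "obsv n m A C s * ctrb_rev n p A B = blockmat m p s n (\<lambda>l j. G (n + l) j)" .
  show ?thesis
    unfolding OC toepT_def H_def add.commute[of s n] hcat_blockmat
    by (rule blockmat_cong) (auto simp: markov_block_def add.commute)
qed

section \<open>Factorization\<close>

text \<open>The four block columns are regrouped into two of widths \<open>(s + n) * p\<close> and
  \<open>(s + n) * m\<close>, matching the block structure of \<open>Theta\<close>.\<close>

lemma Psi_s0_four_block:
  "Psi_s0 n m p A B C D s
    = four_block_mat (last_blocks p n s) (0\<^sub>m (s * p) ((s + n) * m)) (H s) (last_blocks m n s)"
proof -
  have "hcat (hcat (hcat (0\<^sub>m (s * p) (n * p)) (1\<^sub>m (s * p))) (0\<^sub>m (s * p) (n * m))) (0\<^sub>m (s * p) (s * m))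
      = hcat (last_blocks p n s) (0\<^sub>m (s * p) ((s + n) * m))"
    unfolding hcat_zero_one
    by (subst hcat_assoc) (simp_all add: hcat_zero last_blocks_def algebra_simps)
  moreover have "hcat (hcat (hcat (obsv n m A C s * ctrb_rev n p A B) (toepT m p A B C D s)) (0\<^sub>m (s * m) (n * m))) (1\<^sub>m (s * m))
      = hcat (H s) (last_blocks m n s)"
    unfolding hcat_obsv_ctrb_toepT
    by (subst hcat_assoc) (simp_all add: hcat_zero_one H_def)
  ultimately show ?thesis
    unfolding Psi_s0_def by (simp add: vcat_hcat_four_block[of _ "s * p" "(s + n) * p" _ "(s + n) * m" _ "s * m"])
qed

lemma Psibar_s0_four_block:
  "Psibar_s0 n m p A B C D s
    = four_block_mat (last_blocks p n s) (0\<^sub>m (s * p) (s * m)) (H s) (1\<^sub>m (s * m))"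
  unfolding Psibar_s0_def hcat_zero_one hcat_obsv_ctrb_toepT
  by (simp add: vcat_hcat_four_block[of _ "s * p" "(s + n) * p" _ "s * m" _ "s * m"])

lemma Theta_four_block:
  "Theta n m p A B C F L s
    = four_block_mat (Vmat p A B F (s + n)) (Rbarmat m p A B F L (s + n))
        (0\<^sub>m ((s + n) * m) ((s + n) * p)) (Rmat m A C L (s + n))"
  unfolding Theta_def Vmat_def Rbarmat_def Rmat_def
  by (simp add: vcat_hcat_four_block[of _ "(s + n) * p" "(s + n) * p" _ "(s + n) * m" _ "(s + n) * m"])

lemma Psi_s_four_block:
  "Psi_s n m p A B C D F L s
    = four_block_mat (Ms n p A B F s) (Yhs n m p A B F L s)
        (Ns n m p A B C D F s) (Xhs n m A B C D F L s)"
  unfolding Psi_s_def Ms_def Yhs_def Ns_def Xhs_def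
  by (simp add: vcat_hcat_four_block[of _ "s * p" "(s + n) * p" _ "(s + n) * m" _ "s * m"])

text \<open>The closed-loop states \<open>AF A B F ^\<^sub>m i * Z\<close> also solve the open-loop
  recursion with inputs \<open>F * AF A B F ^\<^sub>m i * Z\<close>. Variation of constants then
  gives the part seen through \<open>C\<close>, and splitting \<open>CF C D F\<close> into
  \<open>C + D * F\<close> adds the feedthrough term.\<close>

lemma state_feedback_response:
  assumes Z: "Z \<in> carrier_mat n r" and a: "a < m" and b: "b < r"
  shows "(C\<^sub>F * A\<^sub>F ^\<^sub>m K * Z) $$ (a, b) = (C * A ^\<^sub>m K * Z) $$ (a, b)
    + (\<Sum>i<K. (C * A ^\<^sub>m (K - i - 1) * B * (F * A\<^sub>F ^\<^sub>m i * Z)) $$ (a, b))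
    + (D * (F * A\<^sub>F ^\<^sub>m K * Z)) $$ (a, b)"
proof -
  have Zd [simp]: "dim_row Z = n" "dim_col Z = r" using Z by auto
  have step: "A\<^sub>F ^\<^sub>m Suc j * Z = A * (A\<^sub>F ^\<^sub>m j * Z) + B * (F * A\<^sub>F ^\<^sub>m j * Z)" for j
  proof -
    have "A\<^sub>F ^\<^sub>m Suc j * Z = (A + B * F) * (A\<^sub>F ^\<^sub>m j * Z)"
      unfolding pow_mat_Suc_left[OF AF_carrier, symmetric] by (simp add: mult_mat_assoc_dim) (simp add: AF_def)
    also have "\<dots> = A * (A\<^sub>F ^\<^sub>m j * Z) + B * F * (A\<^sub>F ^\<^sub>m j * Z)"
      by (rule add_mult_distrib_mat[of _ n n _ _ r]) (auto intro: carrier_matI)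
    finally show ?thesis by (simp add: mult_mat_assoc_dim)
  qed
  have "(C * (A\<^sub>F ^\<^sub>m K * Z)) $$ (a, b) = (C * A ^\<^sub>m K * (A\<^sub>F ^\<^sub>m 0 * Z)) $$ (a, b)
      + (\<Sum>i<K. (C * A ^\<^sub>m (K - i - 1) * (B * (F * A\<^sub>F ^\<^sub>m i * Z))) $$ (a, b))"
    by (rule variation_of_constants_mat[where X = "\<lambda>j. A\<^sub>F ^\<^sub>m j * Z", OF A C _ _ step a b]) auto
  moreover have "A\<^sub>F ^\<^sub>m 0 * Z = Z" using Z by simp
  moreover have "C\<^sub>F * A\<^sub>F ^\<^sub>m K * Z = C * (A\<^sub>F ^\<^sub>m K * Z) + D * (F * A\<^sub>F ^\<^sub>m K * Z)"
  proof -
    have "C\<^sub>F * A\<^sub>F ^\<^sub>m K * Z = (C + D * F) * (A\<^sub>F ^\<^sub>m K * Z)"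
      by (simp add: mult_mat_assoc_dim) (simp add: CF_def)
    also have "\<dots> = C * (A\<^sub>F ^\<^sub>m K * Z) + D * F * (A\<^sub>F ^\<^sub>m K * Z)"
      by (rule add_mult_distrib_mat[of _ m n _ _ r]) (auto intro: carrier_matI)
    finally show ?thesis by (simp add: mult_mat_assoc_dim)
  qed
  ultimately show ?thesis using a b by (simp add: mult_mat_assoc_dim)
qed

text \<open>The system receives the feedback inputs generated by a state \<open>Z\<close> placed at
  time \<open>k + 1\<close>. The forced response at time \<open>K\<close> is therefore the
  closed-loop output minus the free response. It is used with \<open>Z = B\<close> and
  \<open>Z = L\<close>.\<close>

lemma G_convolution:
  assumes Z: "Z \<in> carrier_mat n r" and a: "a < m" and b: "b < r" and K: "K < N"
  shows "(\<Sum>j<N. (G K j * (if j > k then F * A\<^sub>F ^\<^sub>m (j - k - 1) * Z else 0\<^sub>m p r)) $$ (a, b))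
    = (if K > k then (C\<^sub>F * A\<^sub>F ^\<^sub>m (K - k - 1) * Z) $$ (a, b) - (C * A ^\<^sub>m (K - k - 1) * Z) $$ (a, b) else 0)"
    (is "sum ?t _ = _")
proof -
  have Zd [simp]: "dim_row Z = n" "dim_col Z = r" using Z by auto
  have FZ: "F * A\<^sub>F ^\<^sub>m i * Z \<in> carrier_mat p r" for i by auto
  \<comment> \<open>Causality of \<open>G\<close> removes \<open>j > K\<close>, and the inputs
    vanish for \<open>j\<close> up to \<open>k\<close>.\<close>
  have zero: "?t j = 0" if "j \<le> k \<or> j > K" for j
    using that a b G_carrier[of K j] FZ[of "j - k - 1"]
    by (auto simp: markov_block_def right_mult_zero_mat[of _ m p] left_mult_zero_mat[of _ p r])
  show ?thesis
  proof (cases "K > k")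
    case False
    then have "sum ?t {..<N} = 0" by (intro sum.neutral ballI zero) linarith
    then show ?thesis using False by simp
  next
    case True
    \<comment> \<open>Time elapsed since the state \<open>Z\<close> at time \<open>k + 1\<close>.
      After shifting the index by \<open>k + 1\<close>, the last summand is the one carrying
      \<open>D\<close>.\<close>
    define K' where "K' = K - k - 1"
    have KK: "K = k + 1 + K'" using True by (simp add: K'_def)
    have "sum ?t {..<N} = sum ?t {k + 1..<k + 1 + Suc K'}"
      using K KK by (intro sum.mono_neutral_right ballI zero) auto
    also have "\<dots> = (\<Sum>i<Suc K'. ?t (k + 1 + i))"
      by (subst sum.atLeastLessThan_shift_0) (simp add: atLeast0LessThan add_ac)
    also have "\<dots> = (\<Sum>i<K'. ?t (k + 1 + i)) + ?t (k + 1 + K')" by simp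
    also have "(\<Sum>i<K'. ?t (k + 1 + i))
        = (\<Sum>i<K'. (C * A ^\<^sub>m (K' - i - 1) * B * (F * A\<^sub>F ^\<^sub>m i * Z)) $$ (a, b))"
      by (rule sum.cong) (auto simp: markov_block_def KK)
    also have "?t (k + 1 + K') = (D * (F * A\<^sub>F ^\<^sub>m K' * Z)) $$ (a, b)"
      by (simp add: markov_block_def KK)
    finally show ?thesis
      using state_feedback_response[OF Z a b, of K'] True by (simp add: K'_def)
  qed
qed

lemma last_blocks_mult_Vmat: "last_blocks p n s * Vmat p A B F (s + n) = Ms n p A B F s"
  unfolding Vmat_def Ms_def
  by (subst last_blocks_mult_blockmat)
    (auto intro!: blockmat_cong simp: Mpar_def nat_lag)

lemma last_blocks_mult_Rbarmat: "last_blocks p n s * Rbarmat m p A B F L (s + n) = Yhs n m p A B F L s"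
  unfolding Rbarmat_def Yhs_def
  by (subst last_blocks_mult_blockmat)
    (auto intro!: blockmat_cong simp: Yhpar_def nat_lag)

text \<open>\<open>Vmat\<close> is the identity plus a strictly lower part. The strictly lower part
  contributes the closed-loop minus the open-loop Markov parameter, and the identity restores the
  open-loop one, including \<open>D\<close> at lag 0.\<close>

lemma H_mult_Vmat: "H s * Vmat p A B F (s + n) = Ns n m p A B C D F s"
  unfolding Vmat_def Ns_def H_def
proof (subst blockmat_mult_blockmat, goal_cases)
  case 3
  show ?case
  proof (rule blockmat_cong)
    fix l k a b assume lk: "l < s" "k < s + n" "a < m" "b < p"
    let ?V = "\<lambda>j. if k < j then F * A\<^sub>F ^\<^sub>m (j - k - 1) * B else if j = k then 1\<^sub>m p else 0\<^sub>m p p"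
    let ?W = "\<lambda>j. if k < j then F * A\<^sub>F ^\<^sub>m (j - k - 1) * B else 0\<^sub>m p p"
    have "(\<Sum>j<s + n. (G (n + l) j * ?V j) $$ (a, b))
        = (\<Sum>j<s + n. (G (n + l) j * ?W j) $$ (a, b) + (if j = k then G (n + l) k $$ (a, b) else 0))"
      using lk by (intro sum.cong) (auto simp: right_mult_one_mat[OF G_carrier] right_mult_zero_mat[OF G_carrier])
    also have "\<dots> = (\<Sum>j<s + n. (G (n + l) j * ?W j) $$ (a, b)) + G (n + l) k $$ (a, b)"
      using lk by (simp add: sum.distrib)
    also have "\<dots> = Npar m p A B C D F (int n + int l - int k) $$ (a, b)"
      using lk by (subst G_convolution[OF B]) (auto simp: Npar_def markov_block_def nat_lag)
    finally show "mat m p (\<lambda>(a, b). \<Sum>j<s + n. (G (n + l) j * ?V j) $$ (a, b)) $$ (a, b)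
        = Npar m p A B C D F (int n + int l - int k) $$ (a, b)"
      using lk by simp
  qed
qed (auto intro: carrier_matI)

text \<open>The free response subtracted in \<open>G_convolution\<close> for \<open>Z = L\<close> is
  exactly the block of \<open>Rmat\<close> below the diagonal, so the two cancel; the identity
  blocks of \<open>Rmat\<close> supply lag 0.\<close>

lemma H_mult_Rbarmat:
  "H s * Rbarmat m p A B F L (s + n) + last_blocks m n s * Rmat m A C L (s + n) = Xhs n m A B C D F L s"
proof -
  have 1: "H s * Rbarmat m p A B F L (s + n) = blockmat m m s (s + n) (\<lambda>l k. mat m m (\<lambda>(a, b).
     \<Sum>j<s + n. (G (n + l) j * (if j > k then F * A\<^sub>F ^\<^sub>m (j - k - 1) * L else 0\<^sub>m p m)) $$ (a, b)))"
    unfolding H_def Rbarmat_def by (rule blockmat_mult_blockmat) (auto intro: carrier_matI)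
  have 2: "last_blocks m n s * Rmat m A C L (s + n) = blockmat m m s (s + n)
     (\<lambda>l j. if n + l > j then C * A ^\<^sub>m (n + l - j - 1) * L else if n + l = j then 1\<^sub>m m else 0\<^sub>m m m)"
    unfolding Rmat_def by (rule last_blocks_mult_blockmat) (auto intro: carrier_matI)
  show ?thesis unfolding 1 2 Xhs_def
  proof (rule eq_matI, goal_cases)
    case (1 x y)
    then have x: "x < s * m" and y: "y < (s + n) * m" by auto
    then show ?case using block_index_split[OF x] block_index_split[OF y]
      by (simp add: index_blockmat G_convolution[OF L])
        (auto simp: Xhpar_def nat_lag)
  qed auto
qed

text \<open>In the notation of the overview, the block product has the entries \<open>E * V\<close>,
  \<open>E * Rbar\<close>, \<open>H * V\<close> and \<open>H * Rbar + E * R\<close>, each computed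
  above.\<close>

lemma Psi_s_factorization:
  "Psi_s n m p A B C D F L s = Psi_s0 n m p A B C D s * Theta n m p A B C F L s"
proof -
  have "Vmat p A B F (s + n) \<in> carrier_mat ((s + n) * p) ((s + n) * p)"
    "Rbarmat m p A B F L (s + n) \<in> carrier_mat ((s + n) * p) ((s + n) * m)"
    "Rmat m A C L (s + n) \<in> carrier_mat ((s + n) * m) ((s + n) * m)"
    "Ms n p A B F s \<in> carrier_mat (s * p) ((s + n) * p)"
    "Yhs n m p A B F L s \<in> carrier_mat (s * p) ((s + n) * m)"
    "Ns n m p A B C D F s \<in> carrier_mat (s * m) ((s + n) * p)"
    by (auto simp: Vmat_def Rbarmat_def Rmat_def Ms_def Yhs_def Ns_def)
  then show ?thesis
    unfolding Psi_s0_four_block Theta_four_block Psi_s_four_block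
    by (simp add: mult_four_block_mat[of _ "s * p" "(s + n) * p" _ "(s + n) * m" _ "s * m" _ _ "(s + n) * p" _ "(s + n) * m"]
      last_blocks_mult_Vmat last_blocks_mult_Rbarmat H_mult_Vmat H_mult_Rbarmat
      left_mult_zero_mat[of _ _ "(s + n) * p"] left_mult_zero_mat[of _ "(s + n) * m" "(s + n) * m"]
      right_mult_zero_mat[of _ "s * m" "(s + n) * m"])
qed

section \<open>Rank\<close>

lemma VR_carrier [simp]:
  "Vmat p A B F N \<in> carrier_mat (N * p) (N * p)"
  "Rbarmat m p A B F L N \<in> carrier_mat (N * p) (N * m)"
  "Rmat m A C L N \<in> carrier_mat (N * m) (N * m)"
  by (auto simp: Vmat_def Rbarmat_def Rmat_def)

lemma Vmat_mult_surj:
  assumes "y \<in> carrier_vec (N * p)"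
  obtains x where "x \<in> carrier_vec (N * p)" "Vmat p A B F N *\<^sub>v x = y"
proof -
  let ?f = "\<lambda>i j. if i > j then F * A\<^sub>F ^\<^sub>m (i - j - 1) * B else if i = j then 1\<^sub>m p else 0\<^sub>m p p"
  obtain x where "x \<in> carrier_vec (N * p)" "blockmat p p N N ?f *\<^sub>v x = y"
    by (rule unit_block_lower_triangular_mult_surj[where f = ?f, OF _ _ assms]) auto
  then show ?thesis using that by (simp add: Vmat_def)
qed

lemma Rmat_mult_surj:
  assumes "y \<in> carrier_vec (N * m)"
  obtains x where "x \<in> carrier_vec (N * m)" "Rmat m A C L N *\<^sub>v x = y"
proof -
  let ?f = "\<lambda>i j. if i > j then C * A ^\<^sub>m (i - j - 1) * L else if i = j then 1\<^sub>m m else 0\<^sub>m m m"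
  obtain x where "x \<in> carrier_vec (N * m)" "blockmat m m N N ?f *\<^sub>v x = y"
    by (rule unit_block_lower_triangular_mult_surj[where f = ?f, OF _ _ assms]) auto
  then show ?thesis using that by (simp add: Rmat_def)
qed

lemma Theta_mult_append:
  assumes "v \<in> carrier_vec ((s + n) * p)" "r \<in> carrier_vec ((s + n) * m)"
  shows "Theta n m p A B C F L s *\<^sub>v (v @\<^sub>v r)
    = (Vmat p A B F (s + n) *\<^sub>v v + Rbarmat m p A B F L (s + n) *\<^sub>v r) @\<^sub>v (Rmat m A C L (s + n) *\<^sub>v r)"
proof -
  have "0\<^sub>m ((s + n) * m) ((s + n) * p) *\<^sub>v v + Rmat m A C L (s + n) *\<^sub>v r = Rmat m A C L (s + n) *\<^sub>v r"
    using assms(1) carrier_matD[OF VR_carrier(3)[of "s + n"]] by (intro eq_vecI) auto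
  then show ?thesis
    unfolding Theta_four_block
    by (subst four_block_mat_mult_vec[OF VR_carrier(1,2) _ VR_carrier(3) assms]) simp_all
qed

text \<open>Shows that \<open>r\<close> enters only through its last \<open>s * m\<close> entries,
  which is what links \<open>Psi_s0\<close> to \<open>Psibar_s0\<close>.\<close>

lemma Psi_s0_mult_append:
  assumes v: "v \<in> carrier_vec ((s + n) * p)" and r: "r \<in> carrier_vec ((s + n) * m)"
  shows "Psi_s0 n m p A B C D s *\<^sub>v (v @\<^sub>v r)
    = vec_last v (s * p) @\<^sub>v (H s *\<^sub>v v + vec_last r (s * m))"
  unfolding Psi_s0_four_block
  by (subst four_block_mat_mult_vec[OF last_blocks_carrier _ H_carrier last_blocks_carrier v r])
    (use r in \<open>auto simp: last_blocks_mult_vec[OF v] last_blocks_mult_vec[OF r]\<close>)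

lemma Psibar_s0_mult_append:
  assumes v: "v \<in> carrier_vec ((s + n) * p)" and r: "r \<in> carrier_vec (s * m)"
  shows "Psibar_s0 n m p A B C D s *\<^sub>v (v @\<^sub>v r) = vec_last v (s * p) @\<^sub>v (H s *\<^sub>v v + r)"
  unfolding Psibar_s0_four_block
  by (subst four_block_mat_mult_vec[OF last_blocks_carrier _ H_carrier one_carrier_mat v r])
    (use r in \<open>auto simp: last_blocks_mult_vec[OF v]\<close>)

lemma Psi_carrier [simp]:
  "Psi_s0 n m p A B C D s \<in> carrier_mat (s * (p + m)) ((s + n) * p + (s + n) * m)"
  "Psibar_s0 n m p A B C D s \<in> carrier_mat (s * (p + m)) ((s + n) * p + s * m)"
  "Theta n m p A B C F L s \<in> carrier_mat ((s + n) * p + (s + n) * m) ((s + n) * p + (s + n) * m)"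
  unfolding Psi_s0_four_block Psibar_s0_four_block Theta_four_block
  by (simp_all add: distrib_left)

lemma Psi_s_mult_append:
  assumes "v \<in> carrier_vec ((s + n) * p)" "r \<in> carrier_vec ((s + n) * m)"
  shows "Psi_s n m p A B C D F L s *\<^sub>v (v @\<^sub>v r)
    = Psi_s0 n m p A B C D s *\<^sub>v ((Vmat p A B F (s + n) *\<^sub>v v + Rbarmat m p A B F L (s + n) *\<^sub>v r)
        @\<^sub>v (Rmat m A C L (s + n) *\<^sub>v r))"
  unfolding Psi_s_factorization Theta_mult_append[OF assms, symmetric]
  by (rule assoc_mult_mat_vec[OF Psi_carrier(1,3)]) (use assms in auto)

text \<open>Forward substitution: the upper part of \<open>y\<close> is placed in the last blocks of
  \<open>v\<close>, with zeros before it, and \<open>w\<close> then corrects the lower part. Both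
  ranks below rest on this splitting.\<close>

lemma Psi_target_split:
  assumes y: "y \<in> carrier_vec (s * (p + m))"
  obtains v w where "v \<in> carrier_vec ((s + n) * p)" "w \<in> carrier_vec (s * m)"
    "y = vec_last v (s * p) @\<^sub>v (H s *\<^sub>v v + w)"
proof -
  define y1 y2 where "y1 = vec_first y (s * p)" and "y2 = vec_last y (s * m)"
  have ys: "y1 \<in> carrier_vec (s * p)" "y2 \<in> carrier_vec (s * m)" by (auto simp: y1_def y2_def)
  define v where "v = 0\<^sub>v (n * p) @\<^sub>v y1"
  have "v \<in> carrier_vec (n * p + s * p)" using ys unfolding v_def by (intro append_carrier_vec) auto
  then have v: "v \<in> carrier_vec ((s + n) * p)" by (simp add: algebra_simps)
  have Hv: "H s *\<^sub>v v \<in> carrier_vec (s * m)" by (rule mult_mat_vec_carrier[OF H_carrier v])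
  have "y = y1 @\<^sub>v y2" using y by (simp add: y1_def y2_def distrib_left)
  also have "\<dots> = vec_last v (s * p) @\<^sub>v (H s *\<^sub>v v + (y2 - H s *\<^sub>v v))"
    using ys(1) by (simp only: vec_diff_add_cancel[OF ys(2) Hv]) (simp add: v_def vec_last_append)
  finally show ?thesis by (rule that[OF v minus_carrier_vec[OF ys(2) Hv]])
qed

lemma mrank_Psibar_s0: "mrank (Psibar_s0 n m p A B C D s) = s * (p + m)"
  unfolding mrank_eq_dim_row_iff[OF Psi_carrier(2)]
proof
  fix y :: "real vec" assume "y \<in> carrier_vec (s * (p + m))"
  then obtain v w where "v \<in> carrier_vec ((s + n) * p)" "w \<in> carrier_vec (s * m)"
    "y = vec_last v (s * p) @\<^sub>v (H s *\<^sub>v v + w)" by (rule Psi_target_split)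
  then show "\<exists>x\<in>carrier_vec ((s + n) * p + s * m). Psibar_s0 n m p A B C D s *\<^sub>v x = y"
    by (intro bexI[of _ "v @\<^sub>v w"]) (auto simp: Psibar_s0_mult_append)
qed

lemma Psi_s0_mult_surj:
  assumes "y \<in> carrier_vec (s * (p + m))"
  obtains v r where "v \<in> carrier_vec ((s + n) * p)" "r \<in> carrier_vec ((s + n) * m)"
    "Psi_s0 n m p A B C D s *\<^sub>v (v @\<^sub>v r) = y"
proof -
  obtain v w where v: "v \<in> carrier_vec ((s + n) * p)" and w: "w \<in> carrier_vec (s * m)"
    and y: "y = vec_last v (s * p) @\<^sub>v (H s *\<^sub>v v + w)" using assms by (rule Psi_target_split)
  \<comment> \<open>The zero padding is harmless, since \<open>Psi_s0\<close> sees only the tail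
    \<open>w\<close>.\<close>
  have "0\<^sub>v (n * m) @\<^sub>v w \<in> carrier_vec (n * m + s * m)" using w by auto
  then have "0\<^sub>v (n * m) @\<^sub>v w \<in> carrier_vec ((s + n) * m)" by (simp add: algebra_simps)
  then show ?thesis using that v w y by (simp add: Psi_s0_mult_append vec_last_append)
qed

lemma mrank_Psi_s0: "mrank (Psi_s0 n m p A B C D s) = s * (p + m)"
  unfolding mrank_eq_dim_row_iff[OF Psi_carrier(1)]
proof
  fix y :: "real vec" assume "y \<in> carrier_vec (s * (p + m))"
  then obtain v r where "v \<in> carrier_vec ((s + n) * p)" "r \<in> carrier_vec ((s + n) * m)"
    "Psi_s0 n m p A B C D s *\<^sub>v (v @\<^sub>v r) = y" by (rule Psi_s0_mult_surj)
  then show "\<exists>x\<in>carrier_vec ((s + n) * p + (s + n) * m). Psi_s0 n m p A B C D s *\<^sub>v x = y"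
    by (intro bexI[of _ "v @\<^sub>v r"]) auto
qed

text \<open>For fixed \<open>r\<close>, move the \<open>Rbarmat\<close> term to the right-hand side
  and solve with the unit triangular \<open>Vmat\<close>.\<close>

lemma Vmat_affine_surj:
  assumes vb: "vb \<in> carrier_vec (N * p)" and r: "r \<in> carrier_vec (N * m)"
  obtains v where "v \<in> carrier_vec (N * p)"
    "Vmat p A B F N *\<^sub>v v + Rbarmat m p A B F L N *\<^sub>v r = vb"
proof -
  have R: "Rbarmat m p A B F L N *\<^sub>v r \<in> carrier_vec (N * p)"
    by (rule mult_mat_vec_carrier[OF VR_carrier(2) r])
  with vb have "vb - Rbarmat m p A B F L N *\<^sub>v r \<in> carrier_vec (N * p)" by auto
  then obtain v where v: "v \<in> carrier_vec (N * p)"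
    and "Vmat p A B F N *\<^sub>v v = vb - Rbarmat m p A B F L N *\<^sub>v r" by (rule Vmat_mult_surj)
  then have "Vmat p A B F N *\<^sub>v v + Rbarmat m p A B F L N *\<^sub>v r = vb"
    by (simp only: vec_diff_add_cancel[OF vb R])
  then show ?thesis using that v by blast
qed

text \<open>A preimage under \<open>Psi_s0\<close> is pulled back through \<open>Theta\<close> by
  back substitution: first \<open>r\<close> from \<open>Rmat\<close>, then \<open>v\<close> from
  \<open>Vmat\<close> with this \<open>r\<close> fixed.\<close>

lemma mrank_Psi_s: "mrank (Psi_s n m p A B C D F L s) = s * (p + m)"
proof -
  have "Psi_s n m p A B C D F L s \<in> carrier_mat (s * (p + m)) ((s + n) * p + (s + n) * m)"
    unfolding Psi_s_factorization by (rule mult_carrier_mat[OF Psi_carrier(1,3)])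
  moreover have "\<exists>x\<in>carrier_vec ((s + n) * p + (s + n) * m). Psi_s n m p A B C D F L s *\<^sub>v x = y"
    if y_carrier: "y \<in> carrier_vec (s * (p + m))" for y
  proof -
    obtain vb rb where vb: "vb \<in> carrier_vec ((s + n) * p)" and rb: "rb \<in> carrier_vec ((s + n) * m)"
      and y: "Psi_s0 n m p A B C D s *\<^sub>v (vb @\<^sub>v rb) = y" using y_carrier by (rule Psi_s0_mult_surj)
    obtain r where r: "r \<in> carrier_vec ((s + n) * m)" "Rmat m A C L (s + n) *\<^sub>v r = rb"
      using rb by (rule Rmat_mult_surj)
    obtain v where v: "v \<in> carrier_vec ((s + n) * p)"
      "Vmat p A B F (s + n) *\<^sub>v v + Rbarmat m p A B F L (s + n) *\<^sub>v r = vb"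
      using vb r(1) by (rule Vmat_affine_surj)
    have "Psi_s n m p A B C D F L s *\<^sub>v (v @\<^sub>v r) = y"
      using Psi_s_mult_append[OF v(1) r(1)] v(2) r(2) y by simp
    then show ?thesis using v(1) r(1) by (intro bexI[of _ "v @\<^sub>v r"]) auto
  qed
  ultimately show ?thesis by (subst mrank_eq_dim_row_iff) auto
qed

section \<open>Representation of solutions\<close>

text \<open>Variation of constants with \<open>M = C\<close>: the input terms together with
  \<open>D\<close> form a row of the full Toeplitz matrix of Markov parameters, and the residual
  terms together with the direct \<open>r\<close> form a row of \<open>Rmat\<close>.\<close>

lemma output_from_zero_state:
  assumes w: "\<And>j. j < s + n \<Longrightarrow> w j \<in> carrier_vec p"
    and r: "\<And>j. j < s + n \<Longrightarrow> r j \<in> carrier_vec m"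
    and z: "\<And>j. j < s + n \<Longrightarrow> z j \<in> carrier_vec n"
    and z0: "z 0 = 0\<^sub>v n"
    and step: "\<And>j. Suc j < s + n \<Longrightarrow> z (Suc j) = A *\<^sub>v z j + (B *\<^sub>v w j + L *\<^sub>v r j)"
  shows "H s *\<^sub>v stackv p (s + n) w + vec_last (Rmat m A C L (s + n) *\<^sub>v stackv m (s + n) r) (s * m)
    = stackv m s (\<lambda>l. C *\<^sub>v z (n + l) + D *\<^sub>v w (n + l) + r (n + l))"
proof -
  let ?R = "\<lambda>i j. if i > j then C * A ^\<^sub>m (i - j - 1) * L else if i = j then 1\<^sub>m m else 0\<^sub>m m m"
  let ?Rr = "\<lambda>i. vec m (\<lambda>a. \<Sum>j<s + n. (?R i j *\<^sub>v r j) $ a)"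
  let ?Gw = "\<lambda>l. vec m (\<lambda>a. \<Sum>j<s + n. (G (n + l) j *\<^sub>v w j) $ a)"
  have R: "Rmat m A C L (s + n) *\<^sub>v stackv m (s + n) r = stackv m (s + n) ?Rr"
    unfolding Rmat_def by (rule blockmat_mult_stackv) (auto intro: carrier_matI r)
  have lastR: "vec_last (stackv m (s + n) ?Rr) (s * m) = stackv m s (\<lambda>l. ?Rr (n + l))"
    unfolding last_blocks_mult_vec[OF stackv_carrier, symmetric]
    by (rule last_blocks_mult_stackv) auto
  have Hw: "H s *\<^sub>v stackv p (s + n) w = stackv m s ?Gw"
    unfolding H_def by (rule blockmat_mult_stackv) (auto intro: w)
  have entry: "(\<Sum>j<s + n. (G K j *\<^sub>v w j) $ a) + (\<Sum>j<s + n. (?R K j *\<^sub>v r j) $ a)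
      = (C *\<^sub>v z K + D *\<^sub>v w K + r K) $ a"
    if K: "K < s + n" and a: "a < m" for K a
  proof -
    have CA: "C * A ^\<^sub>m i \<in> carrier_mat m n" for i by (auto intro: carrier_matI)
    have cw: "B *\<^sub>v w j \<in> carrier_vec n" and cr: "L *\<^sub>v r j \<in> carrier_vec n" if "j < s + n" for j
      using mult_mat_vec_carrier[OF B w[OF that]] mult_mat_vec_carrier[OF L r[OF that]] by auto
    have "(\<Sum>j<s + n. (G K j *\<^sub>v w j) $ a)
        = (\<Sum>j<s + n. if K > j then (C * A ^\<^sub>m (K - j - 1) *\<^sub>v (B *\<^sub>v w j)) $ a
            else if K = j then (D *\<^sub>v w K) $ a else 0)"
    proof (intro sum.cong refl)
      fix j assume "j \<in> {..<s + n}"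
      then have wj: "w j \<in> carrier_vec p" using w by simp
      show "(G K j *\<^sub>v w j) $ a = (if K > j then (C * A ^\<^sub>m (K - j - 1) *\<^sub>v (B *\<^sub>v w j)) $ a
            else if K = j then (D *\<^sub>v w K) $ a else 0)"
        using wj a unfolding markov_block_def assoc_mult_mat_vec[OF CA B wj, symmetric] by auto
    qed
    also have "\<dots> = (\<Sum>j<K. (C * A ^\<^sub>m (K - j - 1) *\<^sub>v (B *\<^sub>v w j)) $ a) + (D *\<^sub>v w K) $ a"
      by (rule sum_lower_triangular[OF K])
    finally have 1: "(\<Sum>j<s + n. (G K j *\<^sub>v w j) $ a) = \<dots>" .
    have "(\<Sum>j<s + n. (?R K j *\<^sub>v r j) $ a)
        = (\<Sum>j<s + n. if K > j then (C * A ^\<^sub>m (K - j - 1) *\<^sub>v (L *\<^sub>v r j)) $ a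
            else if K = j then r K $ a else 0)"
    proof (intro sum.cong refl)
      fix j assume "j \<in> {..<s + n}"
      then have rj: "r j \<in> carrier_vec m" using r by simp
      show "(?R K j *\<^sub>v r j) $ a = (if K > j then (C * A ^\<^sub>m (K - j - 1) *\<^sub>v (L *\<^sub>v r j)) $ a
            else if K = j then r K $ a else 0)"
        using rj a unfolding assoc_mult_mat_vec[OF CA L rj, symmetric] by auto
    qed
    also have "\<dots> = (\<Sum>j<K. (C * A ^\<^sub>m (K - j - 1) *\<^sub>v (L *\<^sub>v r j)) $ a) + r K $ a"
      by (rule sum_lower_triangular[OF K])
    finally have 2: "(\<Sum>j<s + n. (?R K j *\<^sub>v r j) $ a) = \<dots>" .
    have "(C *\<^sub>v z K) $ a = (C * A ^\<^sub>m K *\<^sub>v z 0) $ a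
        + (\<Sum>j<K. (C * A ^\<^sub>m (K - j - 1) *\<^sub>v (B *\<^sub>v w j + L *\<^sub>v r j)) $ a)"
      using K cw cr by (intro variation_of_constants_vec[OF A C _ _ _ a]) (auto intro!: z step)
    \<comment> \<open>The free response disappears because the trajectory starts at the zero
      state.\<close>
    also have "(C * A ^\<^sub>m K *\<^sub>v z 0) $ a = 0"
      using a CA[of K] by (simp add: z0 scalar_prod_right_zero[OF row_carrier_vec[of _ m]])
    also have "(\<Sum>j<K. (C * A ^\<^sub>m (K - j - 1) *\<^sub>v (B *\<^sub>v w j + L *\<^sub>v r j)) $ a)
        = (\<Sum>j<K. (C * A ^\<^sub>m (K - j - 1) *\<^sub>v (B *\<^sub>v w j)) $ a + (C * A ^\<^sub>m (K - j - 1) *\<^sub>v (L *\<^sub>v r j)) $ a)"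
      using K a by (intro sum.cong refl) (simp add: mult_add_distrib_mat_vec[OF CA cw cr])
    finally show ?thesis using 1 2 a K w[OF K] r[OF K] z[OF K] by (simp add: sum.distrib)
  qed
  show ?thesis unfolding R lastR Hw
  proof (rule eq_vecI, goal_cases)
    case (1 i)
    then have i: "i < s * m" by simp
    then show ?case using block_index_split[OF i] entry[of "n + i div m" "i mod m"]
      by (simp add: stackv_def)
  qed simp
qed

text \<open>Full rank of \<open>ctrb\<close> makes it surjective, and a preimage of
  \<open>x\<close>, cut into blocks, is an input sequence in reversed time.\<close>

lemma controllable_reach:
  assumes rank: "mrank (ctrb n p A B) = n" and x: "x \<in> carrier_vec n"
  obtains w where "\<And>j. w j \<in> carrier_vec p"
    "\<And>a. a < n \<Longrightarrow> (\<Sum>j<n. (A ^\<^sub>m (n - j - 1) *\<^sub>v (B *\<^sub>v w j)) $ a) = x $ a"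
proof -
  have "ctrb n p A B \<in> carrier_mat n (n * p)"
    using blockmat_carrier[of n p 1 n] by (simp add: ctrb_def)
  then obtain W where W: "W \<in> carrier_vec (n * p)" and Wx: "ctrb n p A B *\<^sub>v W = x"
    using rank x mrank_eq_dim_row_iff by blast
  define g where "g = (\<lambda>j. vec p (\<lambda>a. W $ (j * p + a)))"
  have "W = stackv p n g" unfolding g_def by (rule stackv_of_vec[OF W])
  then have x_eq: "x = stackv n 1 (\<lambda>i. vec n (\<lambda>a. \<Sum>j<n. (A ^\<^sub>m j * B *\<^sub>v g j) $ a))"
    unfolding Wx[symmetric] ctrb_def
    by (simp only:) (rule blockmat_mult_stackv, auto simp: g_def intro: carrier_matI)
  show ?thesis
  \<comment> \<open>In \<open>ctrb\<close> the block \<open>g j\<close> meets the power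
    \<open>j\<close>, whereas the input at time \<open>j\<close> is propagated by the power
    \<open>n - j - 1\<close>; hence the reversal.\<close>
  proof (rule that[of "\<lambda>j. g (n - Suc j)"])
    fix a assume a: "a < n"
    have "(\<Sum>j<n. (A ^\<^sub>m (n - j - 1) *\<^sub>v (B *\<^sub>v g (n - Suc j))) $ a)
        = (\<Sum>j<n. (A ^\<^sub>m j *\<^sub>v (B *\<^sub>v g j)) $ a)"
      using sum.nat_diff_reindex[of "\<lambda>j. (A ^\<^sub>m j *\<^sub>v (B *\<^sub>v g j)) $ a" n] by simp
    also have "\<dots> = (\<Sum>j<n. (A ^\<^sub>m j * B *\<^sub>v g j) $ a)"
      by (intro sum.cong refl) (simp add: assoc_mult_mat_vec[OF pow_carrier_mat[OF A] B] g_def)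
    also have "\<dots> = x $ a" using a unfolding x_eq by (simp add: stackv_def)
    finally show "(\<Sum>j<n. (A ^\<^sub>m (n - j - 1) *\<^sub>v (B *\<^sub>v g (n - Suc j))) $ a) = x $ a" .
  qed (simp add: g_def)
qed

text \<open>A virtual trajectory \<open>z\<close> starts at zero, is driven by the actual residuals,
  and is steered onto \<open>xh\<close> at index \<open>n\<close>. From then on it receives the
  actual inputs, so the last \<open>s\<close> inputs and outputs are those of the model.\<close>

lemma kernel_model_representation:
  fixes u y r xh :: "int \<Rightarrow> real vec" and k a b :: int
  assumes rank: "mrank (ctrb n p A B) = n" and s: "s \<ge> 1"
    and a: "a \<le> k - int n + 1" and b: "k + int s \<le> b"
    and car: "\<And>t. t \<in> {a..b} \<Longrightarrow> u t \<in> carrier_vec p \<and> y t \<in> carrier_vec m \<and> r t \<in> carrier_vec m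
                         \<and> xh t \<in> carrier_vec n"
    and state: "\<And>t. t \<in> {a..<b} \<Longrightarrow> xh (t + 1) = A *\<^sub>v xh t + B *\<^sub>v u t + L *\<^sub>v r t"
    and out: "\<And>t. t \<in> {a..b} \<Longrightarrow> y t = C *\<^sub>v xh t + D *\<^sub>v u t + r t"
  obtains vb where "vb \<in> carrier_vec ((s + n) * p)"
    "seg p s u k @\<^sub>v seg m s y k
      = Psi_s0 n m p A B C D s *\<^sub>v (vb @\<^sub>v (Rmat m A C L (s + n) *\<^sub>v seg m (s + n) r (k - int n)))"
proof -
  \<comment> \<open>Index \<open>j\<close> stands for time \<open>k - n + 1 + j\<close>, so index
    \<open>n\<close> is time \<open>k + 1\<close> and the indices below \<open>s + n\<close> end at
    time \<open>k + s\<close>.\<close>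
  define rr where "rr = (\<lambda>j. r (k - int n + 1 + int j))"
  have rr: "rr j \<in> carrier_vec m" if "j < s + n" for j
    using car[of "k - int n + 1 + int j"] that a b by (auto simp: rr_def)
  have Lr: "L *\<^sub>v rr j \<in> carrier_vec n" if "j < s + n" for j
    using mult_mat_vec_carrier[OF L rr[OF that]] .
  \<comment> \<open>The state at index \<open>n\<close> produced by the residuals alone; the virtual
    inputs only have to supply the difference to \<open>xh (k + 1)\<close>.\<close>
  define c where "c = vec n (\<lambda>i. \<Sum>j<n. (A ^\<^sub>m (n - j - 1) *\<^sub>v (L *\<^sub>v rr j)) $ i)"
  have xk: "xh (k + 1) \<in> carrier_vec n" using car[of "k + 1"] s a b by auto
  then have "xh (k + 1) - c \<in> carrier_vec n" by (auto simp: c_def)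
  then obtain w0 where w0: "\<And>j. w0 j \<in> carrier_vec p"
    and reach: "\<And>i. i < n \<Longrightarrow> (\<Sum>j<n. (A ^\<^sub>m (n - j - 1) *\<^sub>v (B *\<^sub>v w0 j)) $ i) = (xh (k + 1) - c) $ i"
    using controllable_reach[OF rank] by blast
  \<comment> \<open>The first \<open>n\<close> inputs are free for steering; the later ones must be
    the true inputs, because they form the segment of \<open>u\<close>.\<close>
  define w where "w = (\<lambda>j. if j < n then w0 j else u (k - int n + 1 + int j))"
  have w: "w j \<in> carrier_vec p" if "j < s + n" for j
    using car[of "k - int n + 1 + int j"] that a b w0 by (auto simp: w_def)
  have Bw: "B *\<^sub>v w j \<in> carrier_vec n" if "j < s + n" for j
    using mult_mat_vec_carrier[OF B w[OF that]] .
  define z where "z = rec_nat (0\<^sub>v n) (\<lambda>j x. A *\<^sub>v x + (B *\<^sub>v w j + L *\<^sub>v rr j))"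
  have z0: "z 0 = 0\<^sub>v n" and zSuc: "z (Suc j) = A *\<^sub>v z j + (B *\<^sub>v w j + L *\<^sub>v rr j)" for j
    by (simp_all add: z_def)
  have z: "z j \<in> carrier_vec n" if "j \<le> s + n" for j
    using that
  proof (induction j)
    case (Suc j)
    then have "A *\<^sub>v z j \<in> carrier_vec n" using mult_mat_vec_carrier[OF A] by simp
    then show ?case using Bw[of j] Lr[of j] Suc.prems by (simp add: zSuc)
  qed (simp add: z0)
  \<comment> \<open>Variation of constants with the identity as left factor: the inputs contribute
    \<open>xh (k + 1) - c\<close> and the residuals \<open>c\<close>.\<close>
  have zn: "z n = xh (k + 1)"
  proof (rule eq_vecI, goal_cases)
    case (1 i)
    then have i: "i < n" using xk by simp
    have "(1\<^sub>m n *\<^sub>v z n) $ i = (1\<^sub>m n * A ^\<^sub>m n *\<^sub>v z 0) $ i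
        + (\<Sum>j<n. (1\<^sub>m n * A ^\<^sub>m (n - j - 1) *\<^sub>v (B *\<^sub>v w j + L *\<^sub>v rr j)) $ i)"
      using Bw Lr by (intro variation_of_constants_vec[OF A one_carrier_mat _ _ _ i]) (auto intro!: z zSuc)
    also have "(1\<^sub>m n * A ^\<^sub>m n *\<^sub>v z 0) $ i = 0" using i by (simp add: z0)
    also have "(\<Sum>j<n. (1\<^sub>m n * A ^\<^sub>m (n - j - 1) *\<^sub>v (B *\<^sub>v w j + L *\<^sub>v rr j)) $ i)
        = (\<Sum>j<n. (A ^\<^sub>m (n - j - 1) *\<^sub>v (B *\<^sub>v w0 j)) $ i + (A ^\<^sub>m (n - j - 1) *\<^sub>v (L *\<^sub>v rr j)) $ i)"
    proof (intro sum.cong refl)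
      fix j assume "j \<in> {..<n}"
      then have "j < s + n" "w j = w0 j" by (auto simp: w_def)
      then show "(1\<^sub>m n * A ^\<^sub>m (n - j - 1) *\<^sub>v (B *\<^sub>v w j + L *\<^sub>v rr j)) $ i
          = (A ^\<^sub>m (n - j - 1) *\<^sub>v (B *\<^sub>v w0 j)) $ i + (A ^\<^sub>m (n - j - 1) *\<^sub>v (L *\<^sub>v rr j)) $ i"
        using i Bw[of j] Lr[of j]
        by (simp add: mult_add_distrib_mat_vec[OF pow_carrier_mat[OF A]] left_mult_one_mat[OF pow_carrier_mat[OF A]])
    qed
    also have "\<dots> = (xh (k + 1) - c) $ i + c $ i"
      unfolding sum.distrib reach[OF i] using i by (simp add: c_def)
    also have "\<dots> = xh (k + 1) $ i" using i xk by (simp add: c_def)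
    finally show ?case using z[of n] by simp
  qed (use z[of n] xk in simp)
  \<comment> \<open>Both sequences obey the same recursion with the same data. The step to
    \<open>Suc l < s\<close> uses the state equation at a time before \<open>k + s\<close>, hence
    inside \<open>{a..<b}\<close>.\<close>
  have zl: "z (n + l) = xh (k + 1 + int l)" if "l < s" for l
    using that
  proof (induction l)
    case (Suc l)
    let ?t = "k + 1 + int l"
    have t: "?t \<in> {a..<b}" "?t \<in> {a..b}" using Suc.prems a b by auto
    have "z (n + Suc l) = A *\<^sub>v xh ?t + (B *\<^sub>v u ?t + L *\<^sub>v r ?t)"
      using Suc by (simp add: zSuc w_def rr_def add.commute add.left_commute)
    also have "\<dots> = A *\<^sub>v xh ?t + B *\<^sub>v u ?t + L *\<^sub>v r ?t"
      using car[OF t(2)] by (intro assoc_add_vec[symmetric, of _ n]) (auto intro: mult_mat_vec_carrier[OF A] mult_mat_vec_carrier[OF B] mult_mat_vec_carrier[OF L])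
    also have "\<dots> = xh (?t + 1)" using state[OF t(1)] by simp
    finally show ?case by (simp add: add.commute add.left_commute)
  qed (simp add: zn)
  have segr: "seg m (s + n) r (k - int n) = stackv m (s + n) rr"
    unfolding seg_def rr_def by (rule stackv_cong) simp
  have "H s *\<^sub>v stackv p (s + n) w + vec_last (Rmat m A C L (s + n) *\<^sub>v stackv m (s + n) rr) (s * m)
      = stackv m s (\<lambda>l. C *\<^sub>v z (n + l) + D *\<^sub>v w (n + l) + rr (n + l))"
    by (rule output_from_zero_state) (auto simp: w rr z z0 zSuc)
  also have "\<dots> = seg m s y k"
    unfolding seg_def
  proof (rule stackv_cong)
    fix l i assume l: "l < s"
    then have "k + 1 + int l \<in> {a..b}" using a b by auto
    from out[OF this] show "(C *\<^sub>v z (n + l) + D *\<^sub>v w (n + l) + rr (n + l)) $ i = y (k + 1 + int l) $ i"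
      using zl[OF l] by (simp add: w_def rr_def add.commute add.left_commute)
  qed
  moreover have "vec_last (stackv p (s + n) w) (s * p) = seg p s u k"
    unfolding last_blocks_mult_vec[OF stackv_carrier, symmetric] seg_def
    by (subst last_blocks_mult_stackv[OF w], assumption)
      (auto simp: w_def add.commute add.left_commute intro!: stackv_cong)
  ultimately show ?thesis
    by (intro that[OF stackv_carrier[of p "s + n" w]])
      (simp add: segr Psi_s0_mult_append mult_mat_vec_carrier[OF VR_carrier(3)])
qed

end

theorem theorem2:
  fixes A B C D F L :: "real mat" and n m p s :: nat
  assumes dimA: "A \<in> carrier_mat n n" and dimB: "B \<in> carrier_mat n p"
    and dimC: "C \<in> carrier_mat m n" and dimD: "D \<in> carrier_mat m p"
    and n_pos: "n \<ge> 1" and minimal: "minimal_real n m p A B C"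
    and s_pos: "s \<ge> 1"
    and dimF: "F \<in> carrier_mat p n" and dimL: "L \<in> carrier_mat n m"
  shows "Psi_s n m p A B C D F L s = Psi_s0 n m p A B C D s * Theta n m p A B C F L s
    \<and> (\<forall>(u :: int \<Rightarrow> real vec) (y :: int \<Rightarrow> real vec) (r :: int \<Rightarrow> real vec)
           (xh :: int \<Rightarrow> real vec) (k :: int) (a :: int) (b :: int).
          a \<le> k - int n + 1 \<longrightarrow> k + int s \<le> b \<longrightarrow>
          (\<forall>t\<in>{a..b}. u t \<in> carrier_vec p \<and> y t \<in> carrier_vec m \<and> r t \<in> carrier_vec m
                         \<and> xh t \<in> carrier_vec n) \<longrightarrow>
          (\<forall>t\<in>{a..<b}. xh (t + 1) = A *\<^sub>v xh t + B *\<^sub>v u t + L *\<^sub>v r t) \<longrightarrow>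
          (\<forall>t\<in>{a..b}. y t = C *\<^sub>v xh t + D *\<^sub>v u t + r t) \<longrightarrow>
          (\<exists>v \<in> carrier_vec ((s + n) * p).
            (let rr = seg m (s + n) r (k - int n);
                 vb = Vmat p A B F (s + n) *\<^sub>v v + Rbarmat m p A B F L (s + n) *\<^sub>v rr;
                 rb = Rmat m A C L (s + n) *\<^sub>v rr
             in seg p s u k @\<^sub>v seg m s y k = Psi_s n m p A B C D F L s *\<^sub>v (v @\<^sub>v rr)
              \<and> Psi_s n m p A B C D F L s *\<^sub>v (v @\<^sub>v rr) = Psi_s0 n m p A B C D s *\<^sub>v (vb @\<^sub>v rb)
              \<and> Psi_s0 n m p A B C D s *\<^sub>v (vb @\<^sub>v rb)
                  = Psibar_s0 n m p A B C D s *\<^sub>v (vb @\<^sub>v vec_last rb (s * m)))))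
    \<and> mrank (Psi_s n m p A B C D F L s) = s * (p + m)
    \<and> mrank (Psi_s0 n m p A B C D s) = s * (p + m)
    \<and> mrank (Psibar_s0 n m p A B C D s) = s * (p + m)"
proof -
  interpret lti_with_gains n m p A B C D F L
    by unfold_locales (fact dimA dimB dimC dimD dimF dimL)+
  have rank: "mrank (ctrb n p A B) = n" using minimal by (simp add: minimal_real_def)
  show ?thesis
  proof (intro conjI allI impI, goal_cases)
    case 1
    show ?case by (rule Psi_s_factorization)
  next
    case (2 u y r xh k a b)
    let ?rr = "seg m (s + n) r (k - int n)"
    let ?rb = "Rmat m A C L (s + n) *\<^sub>v ?rr"
    have rr: "?rr \<in> carrier_vec ((s + n) * m)" by (simp add: seg_def)
    have rb: "?rb \<in> carrier_vec ((s + n) * m)" by (rule mult_mat_vec_carrier[OF VR_carrier(3) rr])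
    \<comment> \<open>The transformed input \<open>vb\<close> comes first, from controllability;
      \<open>v\<close> is then recovered by solving the affine equation with the residual segment
      fixed.\<close>
    obtain vb where vb: "vb \<in> carrier_vec ((s + n) * p)"
      and rep: "seg p s u k @\<^sub>v seg m s y k = Psi_s0 n m p A B C D s *\<^sub>v (vb @\<^sub>v ?rb)"
      by (rule kernel_model_representation[OF rank s_pos 2(1,2), of u y r xh]) (use 2 in auto)
    obtain v where v: "v \<in> carrier_vec ((s + n) * p)"
      and Vv: "Vmat p A B F (s + n) *\<^sub>v v + Rbarmat m p A B F L (s + n) *\<^sub>v ?rr = vb"
      using vb rr by (rule Vmat_affine_surj)
    have "Psi_s0 n m p A B C D s *\<^sub>v (vb @\<^sub>v ?rb) = Psibar_s0 n m p A B C D s *\<^sub>v (vb @\<^sub>v vec_last ?rb (s * m))"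
      by (simp add: Psi_s0_mult_append[OF vb rb] Psibar_s0_mult_append[OF vb])
    then show ?case
      using v rep Psi_s_mult_append[OF v rr] by (intro bexI[of _ v]) (simp_all add: Let_def Vv)
  qed (fact mrank_Psi_s mrank_Psi_s0 mrank_Psibar_s0)+
qed

end
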